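(* Let $A$ be a $C^*$-algebra. (a) The following are equivalent: $A$ is discrete; every non-zero closed ideal of $A$ contains a non-zero abelian hereditary $C^*$-subalgebra; every non-zero normal ideal of $A$ contains a non-zero abelian hereditary $C^*$-subalgebra. (b) The following are equivalent: $A$ is of type II; $A$ has no non-zero abelian hereditary $C^*$-subalgebra and every non-zero closed ideal of $A$ contains a non-zero finite hereditary $C^*$-subalgebra; $A$ has no non-zero abelian hereditary $C^*$-subalgebra and every non-zero normal ideal of $A$ contains a non-zero finite hereditary $C^*$-subalgebra. (c) $A$ is of type III if and only if it contains no non-zero finite hereditary $C^*$-subalgebra.
   Context: Ideals are two-sided. For a $C^*$-algebra $A$, $A_+$ is its positive cone; $a\in A_+$ dominates $b\in A_+$ if $b\le a$. An element $x\in A_+$ is abelian in $A$ if $\overline{xAx}$ is commutative. For $x,y\in A_+$ write $x\sim y$ if there is a sequence $(z_k)_{k\in\mathbb N}$ in $A$ with $x=\sum_{k=1}^\infty z_k^*z_k$ and $y=\sum_{k=1}^\infty z_kz_k^*$ (norm convergence). An element $x\in A_+$ is finite in $A$ if $y=x$ whenever $y\in A_+$, $0\le y\le x$ and $y\sim x$. The $C^*$-algebra $A$ is: discrete if every non-zero element of $A_+$ dominates a non-zero abelian element of $A$; finite if every non-zero element of $A_+$ is finite in $A$; semi-finite if every non-zero element of $A_+$ dominates a non-zero positive element that is finite in $A$; of type II if it has no non-zero abelian element and is semi-finite; of type III if it has no non-zero finite element. For an ideal $J\subseteq A$, $J^\perp=\{a\in A: aJ=\{0\}=Ja\}$. A normal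 ideal of $A$ is an ideal of the form $J^\perp$ for some ideal $J\subseteq A$. *)

theory Defs
  imports "HOL-Analysis.Analysis"
begin

text \<open>
  The norm, the completeness and the (not necessarily unital) ring structure come from the library
  classes; the complex scalar multiplication extends the library's real one.  The zero algebra
  is allowed.
\<close>

class cstar_algebra = real_normed_algebra + banach +
  fixes scaleC :: "complex \<Rightarrow> 'a \<Rightarrow> 'a"  (infixr \<open>*\<^sub>C\<close> 75)
    and star :: "'a \<Rightarrow> 'a"
  assumes scaleC_of_real: "complex_of_real r *\<^sub>C x = r *\<^sub>R x"
    and scaleC_add_right: "c *\<^sub>C (x + y) = c *\<^sub>C x + c *\<^sub>C y"
    and scaleC_add_left: "(c + d) *\<^sub>C x = c *\<^sub>C x + d *\<^sub>C x"
    and scaleC_scaleC: "c *\<^sub>C d *\<^sub>C x = (c * d) *\<^sub>C x"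
    and norm_scaleC: "norm (c *\<^sub>C x) = cmod c * norm x"
    and mult_scaleC_left: "(c *\<^sub>C x) * y = c *\<^sub>C (x * y)"
    and mult_scaleC_right: "x * (c *\<^sub>C y) = c *\<^sub>C (x * y)"
    and star_star: "star (star x) = x"
    and star_add: "star (x + y) = star x + star y"
    and star_scaleC: "star (c *\<^sub>C x) = cnj c *\<^sub>C star x"
    and star_mult: "star (x * y) = star y * star x"
    and cstar_identity: "norm (star x * x) = (norm x)\<^sup>2"

definition complex_subspace :: "'a::cstar_algebra set \<Rightarrow> bool" where
  "complex_subspace V \<longleftrightarrow>
     0 \<in> V \<and> (\<forall>x\<in>V. \<forall>y\<in>V. x + y \<in> V) \<and> (\<forall>c. \<forall>x\<in>V. c *\<^sub>C x \<in> V)"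

definition cstar_subalgebra :: "'a::cstar_algebra set \<Rightarrow> bool" where
  "cstar_subalgebra B \<longleftrightarrow>
     complex_subspace B \<and> (\<forall>x\<in>B. \<forall>y\<in>B. x * y \<in> B) \<and> (\<forall>x\<in>B. star x \<in> B) \<and> closed B"

definition commutative_set :: "'a::cstar_algebra set \<Rightarrow> bool" where
  "commutative_set S \<longleftrightarrow> (\<forall>x\<in>S. \<forall>y\<in>S. x * y = y * x)"

text \<open>
  The following notions take as parameter the carrier \<open>A\<close> of the algebra in which they are
  interpreted: \<open>UNIV\<close> for the whole algebra, or a C*-subalgebra regarded as a C*-algebra in its
  own right.  All existential witnesses are then taken in \<open>A\<close>.
\<close>

text \<open>
  Unital or not, positivity is expressed as being of the form \<open>y* y\<close>; for a C*-subalgebra \<open>A\<close> this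
  is the intersection of \<open>A\<close> with the positive cone of the whole algebra.
\<close>

definition pos_cone :: "'a::cstar_algebra set \<Rightarrow> 'a set" where
  "pos_cone A = {star y * y |y. y \<in> A}"

definition dominates :: "'a::cstar_algebra set \<Rightarrow> 'a \<Rightarrow> 'a \<Rightarrow> bool" where
  "dominates A a b \<longleftrightarrow> a \<in> pos_cone A \<and> b \<in> pos_cone A \<and> a - b \<in> pos_cone A"

text \<open>When \<open>A\<close> is a C*-subalgebra it is closed, so the closure below is also the closure in \<open>A\<close>.\<close>

definition abelian_element :: "'a::cstar_algebra set \<Rightarrow> 'a \<Rightarrow> bool" where
  "abelian_element A x \<longleftrightarrow>
     x \<in> pos_cone A \<and> commutative_set (closure {x * a * x |a. a \<in> A})"

text \<open>Cuntz--Pedersen equivalence of positive elements.\<close>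

definition cp_equiv :: "'a::cstar_algebra set \<Rightarrow> 'a \<Rightarrow> 'a \<Rightarrow> bool" where
  "cp_equiv A x y \<longleftrightarrow> x \<in> pos_cone A \<and> y \<in> pos_cone A \<and>
     (\<exists>z :: nat \<Rightarrow> 'a. (\<forall>k. z k \<in> A) \<and>
        (\<lambda>k. star (z k) * z k) sums x \<and> (\<lambda>k. z k * star (z k)) sums y)"

definition finite_element :: "'a::cstar_algebra set \<Rightarrow> 'a \<Rightarrow> bool" where
  "finite_element A x \<longleftrightarrow>
     x \<in> pos_cone A \<and> (\<forall>y. dominates A x y \<and> cp_equiv A y x \<longrightarrow> y = x)"

definition discrete_algebra :: "'a::cstar_algebra set \<Rightarrow> bool" where
  "discrete_algebra A \<longleftrightarrow>
     (\<forall>x\<in>pos_cone A. x \<noteq> 0 \<longrightarrow> (\<exists>y. y \<noteq> 0 \<and> dominates A x y \<and> abelian_element A y))"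

definition finite_algebra :: "'a::cstar_algebra set \<Rightarrow> bool" where
  "finite_algebra A \<longleftrightarrow> (\<forall>x\<in>pos_cone A. x \<noteq> 0 \<longrightarrow> finite_element A x)"

definition semifinite_algebra :: "'a::cstar_algebra set \<Rightarrow> bool" where
  "semifinite_algebra A \<longleftrightarrow>
     (\<forall>x\<in>pos_cone A. x \<noteq> 0 \<longrightarrow> (\<exists>y. y \<noteq> 0 \<and> dominates A x y \<and> finite_element A y))"

definition type_II_algebra :: "'a::cstar_algebra set \<Rightarrow> bool" where
  "type_II_algebra A \<longleftrightarrow> \<not> (\<exists>x. x \<noteq> 0 \<and> abelian_element A x) \<and> semifinite_algebra A"

definition type_III_algebra :: "'a::cstar_algebra set \<Rightarrow> bool" where
  "type_III_algebra A \<longleftrightarrow> \<not> (\<exists>x. x \<noteq> 0 \<and> finite_element A x)"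

definition hereditary_subalgebra :: "'a::cstar_algebra set \<Rightarrow> bool" where
  "hereditary_subalgebra B \<longleftrightarrow> cstar_subalgebra B \<and>
     (\<forall>b\<in>pos_cone B. \<forall>a. dominates UNIV b a \<longrightarrow> a \<in> B)"

definition abelian_hereditary :: "'a::cstar_algebra set \<Rightarrow> bool" where
  "abelian_hereditary B \<longleftrightarrow> hereditary_subalgebra B \<and> commutative_set B"

definition finite_hereditary :: "'a::cstar_algebra set \<Rightarrow> bool" where
  "finite_hereditary B \<longleftrightarrow> hereditary_subalgebra B \<and> finite_algebra B"

text \<open>Two-sided, not necessarily closed.\<close>

definition ideal_of_algebra :: "'a::cstar_algebra set \<Rightarrow> bool" where
  "ideal_of_algebra J \<longleftrightarrow>
     complex_subspace J \<and> (\<forall>a. \<forall>x\<in>J. a * x \<in> J \<and> x * a \<in> J)"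

definition closed_ideal :: "'a::cstar_algebra set \<Rightarrow> bool" where
  "closed_ideal J \<longleftrightarrow> ideal_of_algebra J \<and> closed J"

definition annihilator :: "'a::cstar_algebra set \<Rightarrow> 'a set" where
  "annihilator J = {a. \<forall>x\<in>J. a * x = 0 \<and> x * a = 0}"

definition normal_ideal :: "'a::cstar_algebra set \<Rightarrow> bool" where
  "normal_ideal I \<longleftrightarrow> ideal_of_algebra I \<and> (\<exists>J. ideal_of_algebra J \<and> I = annihilator J)"

end

theory Submission
  imports Defs
begin

text \<open>
  For self-adjoint \<open>e\<close> the corner \<open>{b. e b = b = b e}\<close> is a hereditary C*-subalgebra.  Given
  \<open>z \<noteq> 0\<close>, cutting the spectrum of \<open>z z*\<close> off near zero yields \<open>v = s z\<close> such that the corner of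
  \<open>v v*\<close> is non-zero, lies in \<open>z z* A z z*\<close>, and has all its positive elements below multiples of
  \<open>z z*\<close>.  So a non-zero abelian (finite) element \<open>y\<close> has an abelian (finite) corner
  inside \<open>y A y\<close>, and every non-zero hereditary subalgebra contains a non-zero corner.  Conversely,
  if a hereditary subalgebra \<open>B\<close> lies in the normal ideal generated by \<open>x \<ge> 0\<close>, then some
  \<open>z = x a b\<close> with \<open>b \<in> B\<close> is non-zero; \<open>c \<mapsto> v* c v\<close> embeds the corner of \<open>v v*\<close> into \<open>B\<close>, so
  commutativity or finiteness of \<open>B\<close> passes to elements of that corner, some of which lie below \<open>x\<close>.
\<close>

text \<open>Neither spectra nor representations are used: positivity is a norm inequality in the
  unitization, and the functional calculus is reduced to square roots and one inverse, all norm
  limits of polynomials. The laborious point is then that every \<open>star y * y\<close> is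
  positive. Corners are given by equations rather than as closures of \<open>y A y\<close>. A
  positive element below a member, and every term of a Cuntz-Pedersen decomposition of a member into
  members, then satisfies the same equations, and \<open>star v * c * v\<close> is exactly
  multiplicative in \<open>c\<close> without a polar decomposition. The price is that a corner may
  be zero; hence the cut-off function must equal 1 on a non-trivial part of the spectrum.\<close>

lemma star_0 [simp]: "star (0::'a::cstar_algebra) = 0"
  using star_add[of "0::'a" 0] by simp

lemma star_minus: "star (- x::'a::cstar_algebra) = - star x"
  using star_add[of x "- x"] by (simp add: add_eq_0_iff)

lemma star_diff: "star (x - y::'a::cstar_algebra) = star x - star y"
  using star_add[of x "- y"] by (simp add: star_minus)

lemma star_scaleR: "star (r *\<^sub>R x::'a::cstar_algebra) = r *\<^sub>R star x"
  by (metis complex_cnj_complex_of_real scaleC_of_real star_scaleC)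

lemma norm_star [simp]: "norm (star x::'a::cstar_algebra) = norm x"
proof -
  have le: "norm y \<le> norm (star y)" for y :: 'a
  proof (cases "y = 0")
    case False
    have "norm y * norm y \<le> norm (star y) * norm y"
      using norm_mult_ineq[of "star y" y] by (simp add: cstar_identity power2_eq_square)
    then show ?thesis using False by simp
  qed simp
  show ?thesis using le[of x] le[of "star x"] by (simp add: star_star)
qed

lemma star_mult_self_eq_0: "star x * x = (0::'a::cstar_algebra) \<longleftrightarrow> x = 0"
  by (metis cstar_identity mult_zero_right norm_eq_zero zero_eq_power2)

lemma mult_star_self_eq_0: "x * star x = (0::'a::cstar_algebra) \<longleftrightarrow> x = 0"
  by (metis star_0 star_mult_self_eq_0 star_star)

lemma bounded_linear_star: "bounded_linear (star :: 'a::cstar_algebra \<Rightarrow> 'a)"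
  by (rule bounded_linear_intro[where K=1]) (auto simp: star_add star_scaleR)

lemmas tendsto_star [tendsto_intros] = bounded_linear.tendsto[OF bounded_linear_star]
lemmas continuous_on_star [continuous_intros] =
  bounded_linear.continuous_on[OF bounded_linear_star]

lemma scaleC_0_left [simp]: "0 *\<^sub>C (x::'a::cstar_algebra) = 0"
  using scaleC_of_real[of 0 x] by simp

lemma scaleC_0_right [simp]: "c *\<^sub>C (0::'a::cstar_algebra) = 0"
  using mult_scaleC_right[of "0::'a" c 0] by simp

lemma scaleC_1 [simp]: "1 *\<^sub>C (x::'a::cstar_algebra) = x"
  using scaleC_of_real[of 1 x] by simp

lemma scaleC_minus_right: "c *\<^sub>C (- x::'a::cstar_algebra) = - (c *\<^sub>C x)"
  using scaleC_add_right[of c x "- x"] by (simp add: add_eq_0_iff)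

lemma scaleC_diff_right: "c *\<^sub>C (x - y::'a::cstar_algebra) = c *\<^sub>C x - c *\<^sub>C y"
  using scaleC_add_right[of c x "- y"] by (simp add: scaleC_minus_right)

lemma scaleC_minus_left: "(- c) *\<^sub>C (x::'a::cstar_algebra) = - (c *\<^sub>C x)"
  using scaleC_add_left[of c "- c" x] by (simp add: add_eq_0_iff)

lemma scaleC_scaleR: "c *\<^sub>C (r *\<^sub>R x) = r *\<^sub>R (c *\<^sub>C (x::'a::cstar_algebra))"
  by (simp add: scaleC_scaleC mult.commute flip: scaleC_of_real)

lemma scaleC_real_scaleR: "(r *\<^sub>R c) *\<^sub>C x = r *\<^sub>R (c *\<^sub>C (x::'a::cstar_algebra))"
  by (simp add: scaleC_scaleC scaleR_conv_of_real flip: scaleC_of_real)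

lemma bounded_linear_scaleC: "bounded_linear (\<lambda>x::'a::cstar_algebra. c *\<^sub>C x)"
  by (rule bounded_linear_intro[where K="cmod c"])
     (auto simp: scaleC_add_right scaleC_scaleR norm_scaleC)

section \<open>The unitization\<close>

text \<open>A unit is adjoined even where one exists, which avoids a case distinction. Inverses and
  cut-offs are formed here; products with embedded elements fall back into the original
  algebra.\<close>

datatype 'a uz = Uz (uvec: 'a) (uscal: complex)

lemma uz_eq_iff: "u = v \<longleftrightarrow> uvec u = uvec v \<and> uscal u = uscal v"
  by (cases u; cases v) auto

instantiation uz :: (cstar_algebra) real_algebra_1
begin

definition "0 = Uz 0 0"
definition "1 = Uz 0 1"
definition "u + v = Uz (uvec u + uvec v) (uscal u + uscal v)"
definition "u - v = Uz (uvec u - uvec v) (uscal u - uscal v)"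
definition "- u = Uz (- uvec u) (- uscal u)"
definition "r *\<^sub>R u = Uz (r *\<^sub>R uvec u) (r *\<^sub>R uscal u)"
definition "u * v = Uz (uvec u * uvec v + uscal u *\<^sub>C uvec v + uscal v *\<^sub>C uvec u) (uscal u * uscal v)"

lemmas uz_ops_def = zero_uz_def one_uz_def plus_uz_def minus_uz_def uminus_uz_def
  scaleR_uz_def times_uz_def

instance
  by standard
     (unfold uz_ops_def uz_eq_iff uz.sel, simp_all add: ring_distribs add_ac mult.assoc 
        scaleR_add_left scaleR_add_right mult_scaleC_left mult_scaleC_right
        scaleC_add_left scaleC_add_right scaleC_scaleC scaleC_scaleR scaleC_real_scaleR mult.commute[where ?'a=complex])

end

lemma uz_sel [simp]:
  "uvec 0 = 0" "uscal 0 = 0" "uvec 1 = 0" "uscal 1 = 1"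
  "uvec (u + v) = uvec u + uvec v" "uscal (u + v) = uscal u + uscal v"
  "uvec (u - v) = uvec u - uvec v" "uscal (u - v) = uscal u - uscal v"
  "uvec (- u) = - uvec u" "uscal (- u) = - uscal u"
  "uvec (r *\<^sub>R u) = r *\<^sub>R uvec u" "uscal (r *\<^sub>R u) = r *\<^sub>R uscal u"
  "uvec (u * v) = uvec u * uvec v + uscal u *\<^sub>C uvec v + uscal v *\<^sub>C uvec u"
  "uscal (u * v) = uscal u * uscal v"
  unfolding uz_ops_def by (rule uz.sel)+

text \<open>Left multiplication on the original algebra, an ideal of its unitization. If
  \<open>p\<close> is already a unit there, then \<open>Uz p (- 1)\<close> acts as zero.\<close>

definition uact :: "'a::cstar_algebra uz \<Rightarrow> 'a \<Rightarrow> 'a" where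
  "uact u b = uvec u * b + uscal u *\<^sub>C b"

lemma bounded_linear_uact: "bounded_linear (uact u)"
  unfolding uact_def
  by (intro bounded_linear_add bounded_linear_mult_right bounded_linear_scaleC)

lemma uact_add: "uact (u + v) b = uact u b + uact v b"
  by (simp add: uact_def algebra_simps scaleC_add_left)

lemma uact_mult: "uact (u * v) b = uact u (uact v b)"
  by (simp add: uact_def algebra_simps mult_scaleC_left mult_scaleC_right
        scaleC_add_right scaleC_scaleC)

lemma uact_scaleR: "uact (r *\<^sub>R u) b = r *\<^sub>R uact u b"
  by (simp add: uact_def scaleR_add_right scaleC_real_scaleR)

text \<open>The C*-identity shows that the bound is attained at \<open>star a\<close>. This makes
  \<open>emb\<close> isometric.\<close>

lemma onorm_mult_left_cstar: "onorm ((*) (a::'a::cstar_algebra)) = norm a"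
proof (rule antisym)
  show "onorm ((*) a) \<le> norm a"
    by (rule onorm_bound) (auto simp: norm_mult_ineq)
  have "norm (a * star a) \<le> onorm ((*) a) * norm (star a)"
    by (rule onorm) (rule bounded_linear_mult_right)
  then have "norm a * norm a \<le> onorm ((*) a) * norm a"
    using cstar_identity[of "star a"] by (simp add: star_star power2_eq_square)
  then show "norm a \<le> onorm ((*) a)"
    using onorm_pos_le[OF bounded_linear_mult_right, of a]
    by (cases "a = 0") (simp_all only: norm_zero, auto)
qed

text \<open>Taking the maximum with the modulus of the scalar part keeps the norm definite even when
  the algebra already has a unit.\<close>

instantiation uz :: (cstar_algebra) real_normed_algebra_1
begin

definition "norm u = max (cmod (uscal u)) (onorm (uact u))"
definition "dist u v = norm (u - v :: 'a uz)"
definition "sgn u = u /\<^sub>R norm (u :: 'a uz)"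
definition "uniformity = (INF e\<in>{0 <..}. principal {(u :: 'a uz, v). dist u v < e})"
definition "open U \<longleftrightarrow> (\<forall>u\<in>U. eventually (\<lambda>(v, w). v = u \<longrightarrow> w \<in> U) (uniformity :: ('a uz \<times> 'a uz) filter))"

instance
proof
  fix u v :: "'a uz" and U :: "'a uz set" and r :: real
  show "dist u v = norm (u - v)" by (fact dist_uz_def)
  show "sgn u = u /\<^sub>R norm u" by (fact sgn_uz_def)
  show "uniformity = (INF e\<in>{0 <..}. principal {(u :: 'a uz, v). dist u v < e})"
    by (fact uniformity_uz_def)
  show "open U \<longleftrightarrow> (\<forall>u\<in>U. eventually (\<lambda>(v, w). v = u \<longrightarrow> w \<in> U) uniformity)"
    by (fact open_uz_def)
  show "norm u = 0 \<longleftrightarrow> u = 0"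
  proof
    assume n: "norm u = 0"
    have "0 \<le> cmod (uscal u)" by simp
    then have "uscal u = 0" "onorm (uact u) = 0"
      using n onorm_pos_le[OF bounded_linear_uact, of u] unfolding norm_uz_def max_def
      by (auto split: if_splits)
    moreover have "uact u = (*) (uvec u)" using \<open>uscal u = 0\<close> by (auto simp: uact_def)
    ultimately show "u = 0" by (simp add: uz_eq_iff onorm_mult_left_cstar)
  next
    assume "u = 0"
    then show "norm u = 0" by (simp add: norm_uz_def uact_def[abs_def] onorm_zero)
  qed
  show "norm (u + v) \<le> norm u + norm v"
  proof -
    have "onorm (uact (u + v)) \<le> onorm (uact u) + onorm (uact v)"
      using onorm_triangle[OF bounded_linear_uact bounded_linear_uact, of u v]
      by (simp add: uact_add[abs_def])
    then show ?thesis using norm_triangle_ineq[of "uscal u" "uscal v"]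
      by (auto simp: norm_uz_def)
  qed
  show "norm (r *\<^sub>R u) = \<bar>r\<bar> * norm u"
  proof -
    have "onorm (uact (r *\<^sub>R u)) = \<bar>r\<bar> * onorm (uact u)"
      using onorm_scaleR[OF bounded_linear_uact, of r u] by (simp add: uact_scaleR[abs_def])
    then show ?thesis by (simp add: norm_uz_def max_mult_distrib_left)
  qed
  show "norm (u * v) \<le> norm u * norm v"
  proof -
    have "onorm (uact (u * v)) \<le> onorm (uact u) * onorm (uact v)"
      using onorm_compose[OF bounded_linear_uact bounded_linear_uact, of u v]
      by (simp add: uact_mult[abs_def] comp_def)
    also have "\<dots> \<le> norm u * norm v"
      by (intro mult_mono) (auto simp: norm_uz_def onorm_pos_le bounded_linear_uact le_max_iff_disj)
    finally have "onorm (uact (u * v)) \<le> norm u * norm v" .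
    moreover have "cmod (uscal u) * cmod (uscal v) \<le> norm u * norm v"
      by (intro mult_mono) (auto simp: norm_uz_def le_max_iff_disj)
    then have "cmod (uscal (u * v)) \<le> norm u * norm v"
      by (simp add: norm_mult)
    ultimately show ?thesis by (simp add: norm_uz_def)
  qed
  have "onorm (uact (1 :: 'a uz)) \<le> 1"
    by (rule onorm_bound) (auto simp: uact_def)
  then show "norm (1 :: 'a uz) = 1" by (simp add: norm_uz_def)
qed

end

lemma norm_uact_le: "norm (uact u b) \<le> norm u * norm b"
proof -
  have "norm (uact u b) \<le> onorm (uact u) * norm b"
    by (rule onorm[OF bounded_linear_uact])
  also have "\<dots> \<le> norm u * norm b"
    by (rule mult_right_mono) (auto simp: norm_uz_def)
  finally show ?thesis .
qed

definition emb :: "'a::cstar_algebra \<Rightarrow> 'a uz" where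
  "emb a = Uz a 0"

lemma uvec_emb [simp]: "uvec (emb a) = a" and uscal_emb [simp]: "uscal (emb a) = 0"
  by (simp_all add: emb_def)

lemma emb_uvec: "uscal u = 0 \<Longrightarrow> emb (uvec u) = u"
  by (simp add: uz_eq_iff)

lemma norm_emb [simp]: "norm (emb a) = norm a"
proof -
  have "uact (emb a) = (*) a" by (auto simp: uact_def)
  then show ?thesis by (simp add: norm_uz_def onorm_mult_left_cstar)
qed

lemma norm_uscal_le: "cmod (uscal u) \<le> norm u"
  by (simp add: norm_uz_def)

lemma uz_decomp: "u = emb (uvec u) + Uz 0 (uscal u)"
  by (simp add: uz_eq_iff)

lemma norm_Uz_0: "norm (Uz (0::'a::cstar_algebra) l) = cmod l"
proof -
  have "onorm (uact (Uz (0::'a) l)) \<le> cmod l"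
    by (rule onorm_bound) (auto simp: uact_def norm_scaleC)
  then show ?thesis by (simp add: norm_uz_def)
qed

lemma norm_uz_le: "norm u \<le> norm (uvec u) + cmod (uscal u)"
  using norm_triangle_ineq[of "emb (uvec u)" "Uz 0 (uscal u)"]
  by (simp add: norm_Uz_0 flip: uz_decomp)

lemma norm_uvec_le: "norm (uvec u) \<le> 2 * norm u"
proof -
  have "emb (uvec u) = u - Uz 0 (uscal u)"
    by (simp add: uz_eq_iff)
  then have "norm (uvec u) \<le> norm u + cmod (uscal u)"
    using norm_triangle_ineq4[of u "Uz 0 (uscal u)"] by (metis norm_emb norm_Uz_0)
  then show ?thesis using norm_uscal_le[of u] by simp
qed

lemma bounded_linear_uvec: "bounded_linear uvec"
  by (rule bounded_linear_intro[where K=2]) (simp_all add: norm_uvec_le mult.commute[of _ 2])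

lemma bounded_linear_uscal: "bounded_linear uscal"
  by (rule bounded_linear_intro[where K=1]) (auto simp: norm_uscal_le)

instance uz :: (cstar_algebra) banach
proof
  fix X :: "nat \<Rightarrow> 'a uz" assume X: "Cauchy X"
  obtain a where a: "(\<lambda>n. uvec (X n)) \<longlonglongrightarrow> a"
    using bounded_linear.Cauchy[OF bounded_linear_uvec X] by (auto simp: Cauchy_convergent_iff convergent_def)
  obtain l where l: "(\<lambda>n. uscal (X n)) \<longlonglongrightarrow> l"
    using bounded_linear.Cauchy[OF bounded_linear_uscal X] by (auto simp: Cauchy_convergent_iff convergent_def)
  have "(\<lambda>n. norm (uvec (X n) - a) + cmod (uscal (X n) - l)) \<longlonglongrightarrow> 0 + 0"
    using a l by (intro tendsto_add) (simp_all add: LIM_zero_iff tendsto_norm_zero)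
  then have lim: "(\<lambda>n. norm (uvec (X n) - a) + cmod (uscal (X n) - l)) \<longlonglongrightarrow> 0" by simp
  have "norm (X n - Uz a l) \<le> norm (uvec (X n) - a) + cmod (uscal (X n) - l)" for n
    using norm_uz_le[of "X n - Uz a l"] by simp
  then have "(\<lambda>n. X n - Uz a l) \<longlonglongrightarrow> 0"
    by (intro Lim_null_comparison[OF _ lim] always_eventually allI)
  then show "convergent X"
    unfolding convergent_def using LIM_zero_iff by blast
qed

instantiation uz :: (cstar_algebra) cstar_algebra
begin

definition "c *\<^sub>C u = Uz (c *\<^sub>C uvec u) (c * uscal u)"
definition "star u = Uz (star (uvec u)) (cnj (uscal u))"

instance
proof
  fix u v :: "'a uz" and c d :: complex and r :: real
  show sf: "star (u * v) = star v * star u" for u v :: "'a uz"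
    by (simp add: star_uz_def uz_eq_iff star_add star_mult star_scaleC)
  show ss: "star (star u) = u" for u :: "'a uz"
    by (simp add: star_uz_def uz_eq_iff star_star)
  show "norm (c *\<^sub>C u) = cmod c * norm u"
  proof -
    have le: "onorm (uact (c *\<^sub>C u)) \<le> cmod c * onorm (uact u)" for c and u :: "'a uz"
    proof (rule onorm_bound)
      show "0 \<le> cmod c * onorm (uact u)"
        by (simp add: onorm_pos_le bounded_linear_uact)
      fix b
      have "uact (c *\<^sub>C u) b = c *\<^sub>C uact u b"
        by (simp add: uact_def scaleC_uz_def mult_scaleC_left scaleC_add_right scaleC_scaleC)
      then show "norm (uact (c *\<^sub>C u) b) \<le> cmod c * onorm (uact u) * norm b"
        using onorm[OF bounded_linear_uact, of u b]
        by (simp add: norm_scaleC mult_left_mono mult.assoc)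
    qed
    have "cmod c * onorm (uact u) \<le> onorm (uact (c *\<^sub>C u))"
    proof (cases "c = 0")
      case True
      then show ?thesis by (simp add: onorm_pos_le bounded_linear_uact)
    next
      case False
      have "inverse c *\<^sub>C c *\<^sub>C u = u"
        using False by (simp add: scaleC_uz_def uz_eq_iff scaleC_scaleC)
      then have "onorm (uact u) \<le> inverse (cmod c) * onorm (uact (c *\<^sub>C u))"
        using le[of "inverse c" "c *\<^sub>C u"] by (simp add: norm_inverse)
      then show ?thesis using False by (simp add: field_simps)
    qed
    with le[of c u] have "onorm (uact (c *\<^sub>C u)) = cmod c * onorm (uact u)" by simp
    then show ?thesis
      by (simp add: norm_uz_def scaleC_uz_def norm_mult max_mult_distrib_left)
  qed
  \<comment> \<open>\<open>uact u b\<close> lies in the original algebra, whose C*-identity turns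
    its squared norm into the norm of \<open>star b * uact (star u * u) b\<close>.\<close>
  have le: "(norm u)\<^sup>2 \<le> norm (star u * u)" for u :: "'a uz"
  proof -
    have "norm (uact u b) \<le> sqrt (norm (star u * u)) * norm b" for b
    proof -
      have "star (uact u b) * uact u b = star b * uact (star u * u) b"
        unfolding uact_mult
        by (simp add: uact_def star_uz_def star_add star_mult star_scaleC algebra_simps
             mult_scaleC_left mult_scaleC_right scaleC_add_right scaleC_scaleC)
      then have "(norm (uact u b))\<^sup>2 \<le> norm b * norm (uact (star u * u) b)"
        by (metis cstar_identity norm_mult_ineq norm_star)
      also have "\<dots> \<le> norm b * (norm (star u * u) * norm b)"
        by (intro mult_left_mono norm_uact_le) simp
      also have "\<dots> = (sqrt (norm (star u * u)) * norm b)\<^sup>2"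
        by (simp add: power_mult_distrib power2_eq_square[of "norm b"])
      finally show ?thesis by (rule power2_le_imp_le) simp
    qed
    then have "onorm (uact u) \<le> sqrt (norm (star u * u))"
      by (intro onorm_bound) auto
    moreover have "cmod (uscal u) \<le> sqrt (norm (star u * u))"
    proof (rule real_le_rsqrt)
      show "(cmod (uscal u))\<^sup>2 \<le> norm (star u * u)"
        using norm_uscal_le[of "star u * u"]
        by (simp add: star_uz_def norm_mult power2_eq_square)
    qed
    ultimately have "norm u \<le> sqrt (norm (star u * u))"
      by (simp add: norm_uz_def)
    then show ?thesis by (simp add: real_le_rsqrt sqrt_ge_absD)
  qed
  have le': "norm u \<le> norm (star u)" for u :: "'a uz"
  proof (cases "u = 0")
    case False
    have "norm u * norm u \<le> norm (star u) * norm u"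
      using le[of u] norm_mult_ineq[of "star u" u] by (simp add: power2_eq_square)
    then show ?thesis using False by simp
  qed simp
  have "norm (star u) = norm u"
    using le'[of u] le'[of "star u"] by (simp add: ss)
  then have "norm (star u * u) \<le> (norm u)\<^sup>2"
    using norm_mult_ineq[of "star u" u] by (simp add: power2_eq_square)
  then show "norm (star u * u) = (norm u)\<^sup>2" using le[of u] by simp
qed (simp_all add: scaleC_uz_def star_uz_def uz_eq_iff scaleC_of_real scaleC_add_right
      scaleC_add_left scaleC_scaleC mult_scaleC_left mult_scaleC_right star_star star_add
      star_scaleC algebra_simps scaleR_conv_of_real[where 'a=complex])

end

lemma uz_star_sel [simp]:
  "uvec (star u) = star (uvec u)" "uscal (star u) = cnj (uscal u)"
  "uvec (c *\<^sub>C u) = c *\<^sub>C uvec u" "uscal (c *\<^sub>C u) = c * uscal u"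
  by (simp_all add: star_uz_def scaleC_uz_def)

lemma emb_simps:
  "emb (a + b) = emb a + emb b" "emb (a - b) = emb a - emb b" "emb (a * b) = emb a * emb b"
  "emb (star a) = star (emb a)" "emb (r *\<^sub>R a) = r *\<^sub>R emb a" "emb (- a) = - emb a" "emb 0 = 0"
  by (simp_all add: uz_eq_iff)

lemma emb_eq_iff [simp]: "emb a = emb b \<longleftrightarrow> a = b"
  by (simp add: uz_eq_iff)

lemma bounded_linear_emb: "bounded_linear emb"
  by (rule bounded_linear_intro[where K=1]) (auto simp: emb_simps)

section \<open>Square roots\<close>

lemma commute_prod:
  fixes c :: "'a::semigroup_mult"
  assumes "x * c = c * x" "y * c = c * y"
  shows "x * y * c = c * (x * y)"
  using arg_cong[OF assms(1), of "\<lambda>u. u * y"] arg_cong[OF assms(2), of "\<lambda>u. x * u"]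
  by (simp add: mult.assoc)

text \<open>A fixed point \<open>y\<close> satisfies \<open>2 *\<^sub>R y = r + y * y\<close>, so
  \<open>1 - y\<close> is a square root of \<open>1 - r\<close>. The iterates have no constant term
  and make sense without a unit.\<close>

primrec sqrt_iter :: "'a::real_normed_algebra \<Rightarrow> nat \<Rightarrow> 'a" where
  "sqrt_iter r 0 = 0"
| "sqrt_iter r (Suc n) = (1/2) *\<^sub>R (r + sqrt_iter r n * sqrt_iter r n)"

lemma sqrt_iter_commute: "c * r = r * c \<Longrightarrow> c * sqrt_iter r n = sqrt_iter r n * c"
proof (induction n)
  case (Suc n)
  have "sqrt_iter r n * c = c * sqrt_iter r n" using Suc.IH[OF Suc.prems] by (rule sym)
  from commute_prod[OF this this]
  show ?case using Suc.prems by (simp add: distrib_left distrib_right)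
qed simp

lemma sqrt_iter_1_bounds:
  "0 \<le> sqrt_iter (1::real) n \<and> sqrt_iter (1::real) n \<le> 1
   \<and> sqrt_iter (1::real) n \<le> sqrt_iter 1 (Suc n)"
proof (induction n)
  case (Suc n)
  let ?y = "sqrt_iter (1::real) n" and ?z = "sqrt_iter (1::real) (Suc n)"
  have z: "?z = (1 + ?y * ?y) / 2" by simp
  have y: "0 \<le> ?y" "?y \<le> 1" "?y \<le> ?z" using Suc by auto
  have "?y * ?y \<le> 1 * 1" using y by (intro mult_mono) auto
  then have z1: "0 \<le> ?z" "?z \<le> 1" using y unfolding z by auto
  have "?y * ?y \<le> ?z * ?z" using y by (intro mult_mono) auto
  then have "?z \<le> sqrt_iter 1 (Suc (Suc n))"
    unfolding sqrt_iter.simps(2)[of _ "Suc n"] z[symmetric] using z by simp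
  then show ?case using z1 by blast
qed simp

lemma norm_sqrt_iter:
  assumes "norm r \<le> 1"
  shows "norm (sqrt_iter r n) \<le> sqrt_iter 1 n"
proof (induction n)
  case (Suc n)
  have "norm (sqrt_iter r n * sqrt_iter r n) \<le> sqrt_iter 1 n * sqrt_iter 1 n"
    using Suc sqrt_iter_1_bounds[of n]
    by (intro order_trans[OF norm_mult_ineq] mult_mono) simp_all
  then have "norm (r + sqrt_iter r n * sqrt_iter r n) \<le> 1 + sqrt_iter 1 n * sqrt_iter 1 n"
    using assms by (intro norm_triangle_le) auto
  then show ?case by simp
qed simp

text \<open>Iterates and their increments are polynomials in \<open>r\<close> with nonnegative
  coefficients, so their values at the real number 1 bound their norms. This gives convergence even
  for \<open>norm r = 1\<close>, where a contraction argument fails. The induction step factors a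
  difference of commuting squares.\<close>

lemma norm_sqrt_iter_Suc_diff:
  assumes "norm r \<le> 1"
  shows "norm (sqrt_iter r (Suc n) - sqrt_iter r n) \<le> sqrt_iter 1 (Suc n) - sqrt_iter 1 n"
proof (induction n)
  case 0
  then show ?case using assms by simp
next
  case (Suc n)
  let ?f = "sqrt_iter r" and ?g = "sqrt_iter (1::real)"
  have "?f n * r = r * ?f n" using sqrt_iter_commute[of r r n] by simp
  then have "?f (Suc n) * ?f n = ?f n * ?f (Suc n)"
    using sqrt_iter_commute[of "?f n" r "Suc n"] by simp
  then have "?f (Suc (Suc n)) - ?f (Suc n)
      = (1/2) *\<^sub>R ((?f (Suc n) - ?f n) * (?f (Suc n) + ?f n))"
    by (subst sqrt_iter.simps(2), subst (2) sqrt_iter.simps(2))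
      (simp add: algebra_simps del: sqrt_iter.simps)
  also have "norm \<dots> \<le> (1/2) * ((?g (Suc n) - ?g n) * (?g (Suc n) + ?g n))"
  proof -
    have "norm (?f (Suc n) + ?f n) \<le> ?g (Suc n) + ?g n"
      by (intro norm_triangle_mono norm_sqrt_iter assms)
    then have "norm ((?f (Suc n) - ?f n) * (?f (Suc n) + ?f n))
        \<le> (?g (Suc n) - ?g n) * (?g (Suc n) + ?g n)"
      using Suc.IH sqrt_iter_1_bounds[of n] by (intro order_trans[OF norm_mult_ineq] mult_mono)
        (simp_all del: sqrt_iter.simps)
    then show ?thesis by (simp del: sqrt_iter.simps)
  qed
  also have "\<dots> = ?g (Suc (Suc n)) - ?g (Suc n)"
    by (subst (3) sqrt_iter.simps(2), subst (5) sqrt_iter.simps(2))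
      (simp add: algebra_simps del: sqrt_iter.simps)
  finally show ?case .
qed

text \<open>Quantifying over such sets records that a square root is a limit of polynomials. The
  sets used later are commutants and the preimage of a subalgebra in the unitization.\<close>

definition closed_real_algebra :: "'a::real_normed_algebra set \<Rightarrow> bool" where
  "closed_real_algebra S \<longleftrightarrow> closed S \<and> 0 \<in> S \<and>
     (\<forall>x\<in>S. \<forall>y\<in>S. x + y \<in> S \<and> x * y \<in> S) \<and> (\<forall>r. \<forall>x\<in>S. r *\<^sub>R x \<in> S)"

lemma closed_real_algebra_commutant: "closed_real_algebra {x. x * c = c * x}"
proof -
  have "closed {x. x * c = c * x}"
    by (intro closed_Collect_eq continuous_intros)
  then show ?thesis
    unfolding closed_real_algebra_def
    by (auto simp: distrib_left distrib_right intro: commute_prod)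
qed

lemma closed_real_algebra_minus:
  assumes "closed_real_algebra S" "x \<in> S" "y \<in> S"
  shows "x - y \<in> S"
proof -
  have "x + (- 1) *\<^sub>R y \<in> S" using assms unfolding closed_real_algebra_def by blast
  then show ?thesis by simp
qed

lemma sqrt_one_minus_exists:
  fixes r :: "'a::cstar_algebra"
  assumes r: "norm r \<le> 1" and sa: "star r = r"
  shows "\<exists>y. 2 *\<^sub>R y = r + y * y \<and> star y = y \<and> norm y \<le> 1 \<and>
    (\<forall>S. closed_real_algebra S \<and> r \<in> S \<longrightarrow> y \<in> S)"
proof -
  let ?f = "sqrt_iter r" and ?g = "sqrt_iter (1::real)"
  have inc: "incseq ?g" using sqrt_iter_1_bounds by (auto simp: incseq_Suc_iff simp del: sqrt_iter.simps)
  obtain L where "?g \<longlonglongrightarrow> L"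
    using incseq_convergent[OF inc, of 1] sqrt_iter_1_bounds by blast
  then have cg: "Cauchy ?g" by (simp add: convergent_Cauchy convergentI)
  have diff: "norm (?f (n + k) - ?f n) \<le> ?g (n + k) - ?g n" for n k
  proof (induction k)
    case (Suc k)
    have "norm (?f (n + Suc k) - ?f n)
        \<le> norm (?f (Suc (n + k)) - ?f (n + k)) + norm (?f (n + k) - ?f n)"
      using norm_triangle_ineq[of "?f (Suc (n + k)) - ?f (n + k)" "?f (n + k) - ?f n"]
      by (simp del: sqrt_iter.simps)
    also have "\<dots> \<le> ?g (n + Suc k) - ?g n"
      using Suc norm_sqrt_iter_Suc_diff[OF r, of "n + k"] by (simp del: sqrt_iter.simps)
    finally show ?case .
  qed simp
  have "Cauchy ?f"
  proof (rule CauchyI')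
    fix e :: real assume "0 < e"
    then obtain M where M: "\<And>m n. m \<ge> M \<Longrightarrow> n \<ge> M \<Longrightarrow> norm (?g m - ?g n) < e"
      using CauchyD[OF cg] by blast
    have "dist (?f m) (?f n) < e" if "m \<ge> M" "n > m" for m n
    proof -
      have "norm (?f n - ?f m) \<le> ?g n - ?g m"
        using diff[of m "n - m"] that by simp
      also have "\<dots> < e" using M[of n m] that by simp
      finally show ?thesis by (simp add: dist_norm norm_minus_commute)
    qed
    then show "\<exists>M. \<forall>m\<ge>M. \<forall>n>m. dist (?f m) (?f n) < e" by blast
  qed
  then obtain y where y: "?f \<longlonglongrightarrow> y" by (auto simp: Cauchy_convergent_iff convergent_def)
  have "(\<lambda>n. ?f (Suc n)) \<longlonglongrightarrow> (1/2) *\<^sub>R (r + y * y)"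
    unfolding sqrt_iter.simps by (intro tendsto_intros y)
  then have "y = (1/2) *\<^sub>R (r + y * y)"
    using LIMSEQ_unique LIMSEQ_Suc[OF y] by blast
  then have "2 *\<^sub>R y = 2 *\<^sub>R ((1/2) *\<^sub>R (r + y * y))" by (rule arg_cong)
  then have eq: "2 *\<^sub>R y = r + y * y" by simp
  have "star (?f n) = ?f n" for n
    by (induction n) (auto simp: star_scaleR star_add star_mult sa)
  then have "?f \<longlonglongrightarrow> star y" using tendsto_star[OF y] by simp
  then have sy: "star y = y" using LIMSEQ_unique y by blast
  have "norm (?f n) \<le> 1" for n
    using norm_sqrt_iter[OF r, of n] sqrt_iter_1_bounds[of n] by linarith
  then have ny: "norm y \<le> 1"
    using LIMSEQ_le_const2[OF tendsto_norm[OF y]] by blast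
  have "y \<in> S" if S: "closed_real_algebra S" "r \<in> S" for S
  proof -
    have "?f n \<in> S" for n
    proof (induction n)
      case 0
      then show ?case using S by (simp add: closed_real_algebra_def)
    next
      case (Suc n)
      then show ?case using S unfolding closed_real_algebra_def sqrt_iter.simps by blast
    qed
    then show ?thesis using S y closed_sequentially unfolding closed_real_algebra_def by blast
  qed
  then show ?thesis using eq sy ny by blast
qed

section \<open>Positivity in a unital algebra\<close>

text \<open>For \<open>u = a + i b\<close> the commuting elements give
  \<open>star u * u = a * a + b * b\<close>, while \<open>2 a = u + star u\<close> bounds
  \<open>norm a\<close> by \<open>norm u\<close>. This inequality stands in for the commutative
  functional calculus.\<close>

lemma norm_le_norm_sum_squares:
  fixes a b :: "'a::cstar_algebra"
  assumes "star a = a" "star b = b" "a * b = b * a"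
  shows "(norm a)\<^sup>2 \<le> norm (a * a + b * b)"
proof -
  define u where "u = a + \<i> *\<^sub>C b"
  have su: "star u = a + (- \<i>) *\<^sub>C b"
    using assms by (simp add: u_def star_add star_scaleC)
  have "star u * u = a * a + b * b"
    using assms(3) unfolding su by (simp add: u_def algebra_simps mult_scaleC_left mult_scaleC_right scaleC_scaleC
        scaleC_minus_left scaleC_add_right scaleC_diff_right)
  then have nu: "norm (a * a + b * b) = (norm u)\<^sup>2" by (metis cstar_identity)
  have "2 *\<^sub>R a = u + star u" unfolding su by (simp add: u_def scaleC_minus_left scaleR_2)
  then have "2 * norm a \<le> 2 * norm u"
    by (metis norm_star norm_triangle_ineq norm_scaleR abs_numeral mult_2)
  then show ?thesis unfolding nu by (intro power_mono) auto
qed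

lemma norm_square_sa: "star k = k \<Longrightarrow> norm (k * k :: 'a::cstar_algebra) = (norm k)\<^sup>2"
  by (metis cstar_identity)

lemma square_eq_0_sa: "star k = k \<Longrightarrow> k * k = (0 :: 'a::cstar_algebra) \<longleftrightarrow> k = 0"
  by (metis star_mult_self_eq_0)

lemma star_1 [simp]: "star (1::'a::{cstar_algebra,real_normed_algebra_1}) = 1"
  by (metis mult.right_neutral mult_1 star_mult star_star)

text \<open>For self-adjoint \<open>h\<close>, the existence of such a \<open>t\<close> says that the spectrum of \<open>h\<close> lies in
  \<open>[0, 2t]\<close>.\<close>

definition psd :: "'a::{cstar_algebra,real_normed_algebra_1} \<Rightarrow> bool" where
  "psd h \<longleftrightarrow> star h = h \<and> (\<exists>t. norm (t *\<^sub>R 1 - h) \<le> t)"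

lemma psd_sa: "psd h \<Longrightarrow> star h = h"
  by (simp add: psd_def)

lemma psd_0 [simp]: "psd 0"
  by (auto simp: psd_def intro!: exI[of _ 0])

lemma psd_add: "psd a \<Longrightarrow> psd b \<Longrightarrow> psd (a + b)"
proof -
  assume "psd a" "psd b"
  then obtain s t where st: "star a = a" "star b = b" "norm (s *\<^sub>R 1 - a) \<le> s" "norm (t *\<^sub>R 1 - b) \<le> t"
    by (auto simp: psd_def)
  have "(s + t) *\<^sub>R 1 - (a + b) = (s *\<^sub>R 1 - a) + (t *\<^sub>R 1 - b)" by (simp add: algebra_simps)
  then have "norm ((s + t) *\<^sub>R 1 - (a + b)) \<le> s + t"
    using st norm_triangle_mono by metis
  then show ?thesis using st by (auto simp: psd_def star_add)
qed

lemma psd_scaleR: "psd a \<Longrightarrow> 0 \<le> c \<Longrightarrow> psd (c *\<^sub>R a)"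
proof -
  assume "psd a" and c: "0 \<le> c"
  then obtain s where s: "star a = a" "norm (s *\<^sub>R 1 - a) \<le> s"
    by (auto simp: psd_def)
  have "(c * s) *\<^sub>R 1 - c *\<^sub>R a = c *\<^sub>R (s *\<^sub>R 1 - a)" by (simp add: algebra_simps)
  then have "norm ((c * s) *\<^sub>R 1 - c *\<^sub>R a) \<le> c * s"
    using s c by (simp add: mult_left_mono)
  then show ?thesis using s by (auto simp: psd_def star_scaleR)
qed

lemma psd_norm_minus: "star h = h \<Longrightarrow> psd (norm h *\<^sub>R 1 - h)"
  unfolding psd_def by (auto simp: star_diff star_scaleR intro!: exI[of _ "norm h"])

lemma psd_norm_plus: "star h = h \<Longrightarrow> psd (norm h *\<^sub>R 1 + h)"
  unfolding psd_def by (auto simp: star_add star_scaleR intro!: exI[of _ "norm h"])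

text \<open>After scaling to \<open>norm l = 1\<close>, a root \<open>1 - y\<close> of
  \<open>1 - l * l\<close> commutes with \<open>l\<close>. The squares of \<open>1 - y\<close> and
  \<open>l\<close> add up to 1, so the first has norm at most 1.\<close>

lemma psd_square:
  fixes k :: "'a::{cstar_algebra,real_normed_algebra_1}"
  assumes sk: "star k = k"
  shows "psd (k * k)"
proof (cases "k = 0")
  case False
  define c where "c = norm k"
  have c: "c > 0" using False by (simp add: c_def)
  define l where "l = (1 / c) *\<^sub>R k"
  have kl: "k = c *\<^sub>R l" using c by (simp add: l_def)
  have sl: "star l = l" using sk by (simp add: l_def star_scaleR)
  have nl: "norm l = 1" using c by (simp add: l_def c_def)
  then have n1: "norm (l * l) \<le> 1" by (simp add: norm_square_sa[OF sl])
  obtain y where y: "2 *\<^sub>R y = l * l + y * y" "star y = y"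
    "\<forall>S. closed_real_algebra S \<and> l * l \<in> S \<longrightarrow> y \<in> S"
    using sqrt_one_minus_exists[OF n1] sl by (auto simp: star_mult)
  have "y \<in> {x. x * l = l * x}"
    using y(3)[rule_format, of "{x. x * l = l * x}"] closed_real_algebra_commutant[of l]
    by (simp add: mult.assoc)
  then have com: "l * (1 - y) = (1 - y) * l" by (simp add: algebra_simps)
  have sq: "(1 - y) * (1 - y) = 1 - l * l"
    using y(1) by (simp add: algebra_simps scaleR_2)
  have sy: "star (1 - y) = 1 - y" using y(2) by (simp add: star_diff)
  have "norm (1 - l * l) \<le> 1"
    using norm_le_norm_sum_squares[OF sy sl com[symmetric]] sy
    by (simp add: norm_square_sa flip: sq) (simp add: sq)
  moreover have "c\<^sup>2 *\<^sub>R 1 - k * k = c\<^sup>2 *\<^sub>R (1 - l * l)"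
    by (simp add: kl power2_eq_square algebra_simps)
  ultimately have "norm (c\<^sup>2 *\<^sub>R 1 - k * k) \<le> c\<^sup>2"
    by (simp add: mult_left_le)
  then show ?thesis using sk by (auto simp: psd_def star_mult)
qed simp

text \<open>Only the three listed properties are ever used, so no uniqueness of the root has to be
  shown. The last one lets the root inherit commutation relations and location from
  \<open>h\<close>.\<close>

definition psqrt :: "'a::{cstar_algebra,real_normed_algebra_1} \<Rightarrow> 'a" where
  "psqrt h = (SOME q. psd q \<and> q * q = h \<and>
     (\<forall>S. closed_real_algebra S \<and> 1 \<in> S \<and> h \<in> S \<longrightarrow> q \<in> S))"

lemma psqrt_aux:
  assumes "psd h"
  shows "psd (psqrt h) \<and> psqrt h * psqrt h = h \<and>
    (\<forall>S. closed_real_algebra S \<and> 1 \<in> S \<and> h \<in> S \<longrightarrow> psqrt h \<in> S)"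
proof -
  obtain t where sh: "star h = h" and t: "norm (t *\<^sub>R 1 - h) \<le> t"
    using assms by (auto simp: psd_def)
  let ?P = "\<lambda>q. psd q \<and> q * q = h \<and>
    (\<forall>S. closed_real_algebra S \<and> 1 \<in> S \<and> h \<in> S \<longrightarrow> q \<in> S)"
  show ?thesis unfolding psqrt_def
  proof (cases "t = 0")
    case True
    then have "h = 0" using t by simp
    then show "?P (SOME q. ?P q)" by (intro someI[of ?P 0]) (auto simp: closed_real_algebra_def)
  next
    case False
    have t0: "t > 0" using t False norm_ge_zero[of "t *\<^sub>R 1 - h"] by linarith
    \<comment> \<open>Chosen so that \<open>1 - r = (1 / t) *\<^sub>R h\<close>; the bound on
      \<open>t *\<^sub>R 1 - h\<close> is exactly \<open>norm r \<le> 1\<close>.\<close>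
    define r where "r = 1 - (1 / t) *\<^sub>R h"
    have "r = (1 / t) *\<^sub>R (t *\<^sub>R 1 - h)" using t0 by (simp add: r_def algebra_simps)
    then have "norm r = (1 / t) * norm (t *\<^sub>R 1 - h)" using t0 by simp
    then have nr: "norm r \<le> 1" using t t0 by (simp add: pos_divide_le_eq)
    have sr: "star r = r" using sh by (simp add: r_def star_diff star_scaleR)
    obtain y where y: "2 *\<^sub>R y = r + y * y" "star y = y" "norm y \<le> 1"
      "\<And>S. closed_real_algebra S \<Longrightarrow> r \<in> S \<Longrightarrow> y \<in> S"
      using sqrt_one_minus_exists[OF nr sr] by blast
    define q where "q = sqrt t *\<^sub>R (1 - y)"
    have sq: "(1 - y) * (1 - y) = 1 - r"
      using y(1) by (simp add: algebra_simps scaleR_2)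
    show "?P (SOME q. ?P q)"
    proof (intro someI[of ?P q] conjI allI impI; (elim conjE)?)
      have "sqrt t *\<^sub>R 1 - q = sqrt t *\<^sub>R y" by (simp add: q_def algebra_simps)
      then have "norm (sqrt t *\<^sub>R 1 - q) \<le> sqrt t"
        using y(3) t0 by (simp add: mult_left_le)
      then show "psd q" using y(2) by (auto simp: psd_def q_def star_scaleR star_diff)
      have "q * q = t *\<^sub>R ((1 - y) * (1 - y))"
        using t0 by (simp add: q_def)
      then show "q * q = h" unfolding sq using t0 by (simp add: r_def)
      fix S :: "'a set" assume S: "closed_real_algebra S" "1 \<in> S" "h \<in> S"
      have "(1 / t) *\<^sub>R h \<in> S" using S by (auto simp: closed_real_algebra_def)
      then have "r \<in> S" unfolding r_def using S closed_real_algebra_minus by blast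
      then have "1 - y \<in> S" using S y(4) closed_real_algebra_minus by blast
      then show "q \<in> S" unfolding q_def using S by (auto simp: closed_real_algebra_def)
    qed
  qed
qed

lemmas psd_psqrt = psqrt_aux[THEN conjunct1]
  and psqrt_square = psqrt_aux[THEN conjunct2, THEN conjunct1]

lemma psqrt_in:
  "psd h \<Longrightarrow> closed_real_algebra S \<Longrightarrow> 1 \<in> S \<Longrightarrow> h \<in> S \<Longrightarrow> psqrt h \<in> S"
  using psqrt_aux by blast

lemma psqrt_commute:
  assumes "psd h" "c * h = h * c"
  shows "c * psqrt h = psqrt h * c"
proof -
  have "psqrt h \<in> {x. x * c = c * x}"
    by (rule psqrt_in[OF assms(1) closed_real_algebra_commutant]) (use assms(2) in auto)
  then show ?thesis by simp
qed

text \<open>For the commuting roots \<open>a\<close> of \<open>h\<close> and \<open>b\<close> of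
  \<open>- h\<close>, the square of \<open>a * b\<close> is \<open>- (h * h)\<close>. So
  \<open>h * h\<close> plus the square of a commuting self-adjoint element vanishes.\<close>

lemma psd_antisym:
  assumes "psd h" "psd (- h)"
  shows "h = 0"
proof -
  define a where "a = psqrt h"
  define b where "b = psqrt (- h)"
  have a: "psd a" "a * a = h" and b: "psd b" "b * b = - h"
    using assms by (simp_all add: a_def b_def psd_psqrt psqrt_square)
  have bh: "h * b = b * h" unfolding b_def by (rule psqrt_commute[OF assms(2)]) simp
  have ah: "h * a = a * h" unfolding a_def by (rule psqrt_commute[OF assms(1)]) simp
  have ab: "b * a = a * b" unfolding a_def by (rule psqrt_commute[OF assms(1)]) (rule bh[symmetric])
  have "star (a * b) = a * b" using a b ab by (simp add: star_mult psd_sa)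
  moreover have "a * b * h = h * (a * b)"
    by (rule commute_prod) (use ah bh in simp_all)
  ultimately have "(norm h)\<^sup>2 \<le> norm (h * h + a * b * (a * b))"
    using psd_sa[OF assms(1)] by (intro norm_le_norm_sum_squares) simp_all
  also have "a * b * (a * b) = (a * a) * (b * b)"
    using arg_cong[OF ab, of "\<lambda>x. a * x * b"] by (simp add: mult.assoc)
  finally show ?thesis unfolding a b by simp
qed

text \<open>The squares of the roots of \<open>h\<close> and of \<open>t *\<^sub>R 1 - h\<close> sum
  to \<open>t *\<^sub>R 1\<close>, and \<open>norm_le_norm_sum_squares\<close> applies.\<close>

lemma norm_le_if_psd:
  assumes "psd h" "psd (t *\<^sub>R 1 - h)"
  shows "norm h \<le> \<bar>t\<bar>"
proof -
  define a where "a = psqrt h"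
  define b where "b = psqrt (t *\<^sub>R 1 - h)"
  have a: "psd a" "a * a = h" and b: "psd b" "b * b = t *\<^sub>R 1 - h"
    using assms by (simp_all add: a_def b_def psd_psqrt psqrt_square)
  have ah: "h * a = a * h" unfolding a_def by (rule psqrt_commute[OF assms(1)]) simp
  have "a * b = b * a" unfolding b_def
    by (rule psqrt_commute[OF assms(2)]) (simp add: algebra_simps ah)
  then have "(norm a)\<^sup>2 \<le> norm (a * a + b * b)"
    using a b by (intro norm_le_norm_sum_squares) (auto simp: psd_sa)
  then show ?thesis using norm_square_sa[OF psd_sa[OF a(1)]] unfolding a b by simp
qed

text \<open>Fixing the witness \<open>t\<close> as \<open>norm h\<close> replaces the existential by
  a closed condition.\<close>

lemma psd_iff_norm:
  "psd h \<longleftrightarrow> star h = h \<and> norm (norm h *\<^sub>R 1 - h) \<le> norm h"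
proof
  assume h: "psd h"
  then have "psd (norm h *\<^sub>R 1 - (norm h *\<^sub>R 1 - h))" by simp
  from norm_le_if_psd[OF psd_norm_minus[OF psd_sa[OF h]] this]
  show "star h = h \<and> norm (norm h *\<^sub>R 1 - h) \<le> norm h" using psd_sa[OF h] by simp
qed (auto simp: psd_def)

lemma closed_psd: "closed {h. psd h}"
  unfolding psd_iff_norm
  by (intro closed_Collect_conj closed_Collect_eq closed_Collect_le continuous_intros)

section \<open>Norms of powers, and negativity of \<open>z * star z\<close> from that of
  \<open>star z * z\<close>\<close>

lemma norm_power_two_power_sa:
  fixes g :: "'a::{cstar_algebra,real_normed_algebra_1}"
  assumes "star g = g"
  shows "norm (g ^ (2 ^ k)) = norm g ^ (2 ^ k)"
proof (induction k)
  case (Suc k)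
  have "star (g ^ n) = g ^ n" for n
    by (induction n) (auto simp: star_mult assms power_commutes)
  then have "norm (g ^ 2 ^ k * g ^ 2 ^ k) = (norm (g ^ 2 ^ k))\<^sup>2"
    by (rule norm_square_sa)
  then show ?case using Suc by (simp add: mult_2 power_add power2_eq_square)
qed simp

text \<open>If \<open>x = 1 + d\<close> with \<open>d > 0\<close>, Bernoulli gives
  \<open>x ^ n \<ge> 1 + n d\<close>. Squaring makes the bound on \<open>x ^ (2 n)\<close> quadratic
  in \<open>n\<close>, which eventually beats \<open>2 n + 1\<close>.\<close>

lemma le_1_if_power_le_linear:
  fixes x :: real
  assumes "x \<ge> 0" and le: "\<And>k. x ^ (2 ^ k) \<le> 2 ^ k + 1"
  shows "x \<le> 1"
proof (rule ccontr)
  assume "\<not> x \<le> 1"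
  define d where "d = x - 1"
  have d: "d > 0" using \<open>\<not> x \<le> 1\<close> by (simp add: d_def)
  obtain k :: nat where k: "2 / d\<^sup>2 < real k" using reals_Archimedean2 by blast
  define n :: nat where "n = 2 ^ k"
  have n: "2 / d\<^sup>2 < real n"
  proof -
    have "k < n" by (simp add: n_def)
    then show ?thesis using k by linarith
  qed
  have "1 + real n * d \<le> x ^ n"
    using Bernoulli_inequality[of d n] d by (simp add: d_def)
  then have "(1 + real n * d)\<^sup>2 \<le> (x ^ n)\<^sup>2"
    using d by (intro power_mono) auto
  also have "(x ^ n)\<^sup>2 = x ^ (2 ^ Suc k)"
    by (simp add: n_def flip: power_mult) (simp add: mult.commute)
  also have "\<dots> \<le> 2 * real n + 1" using le[of "Suc k"] by (simp add: n_def)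
  finally have "2 * real n * d + real n * (real n * d\<^sup>2) \<le> 2 * real n"
    by (simp add: power2_eq_square algebra_simps)
  moreover have "2 < real n * d\<^sup>2" using n d by (simp add: field_simps)
  then have "real n * 2 < real n * (real n * d\<^sup>2)"
    by (intro mult_strict_left_mono) (auto simp: n_def)
  moreover have "0 \<le> 2 * real n * d" using d by simp
  ultimately show False by linarith
qed

text \<open>Replaces the fact that \<open>z* z\<close> and \<open>z z*\<close> have the same non-zero spectrum: the powers of
  \<open>t + z z*\<close> are controlled by those of \<open>t + z* z\<close>, and the spectral radius formula concludes.\<close>

lemma psd_minus_swap:
  fixes z :: "'a::{cstar_algebra,real_normed_algebra_1}"
  assumes "psd (- (star z * z))"
  shows "psd (- (z * star z))"
proof (cases "z = 0")
  case False
  \<comment> \<open>This is the norm of \<open>star z * z\<close>, so \<open>psd_iff_norm\<close>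
    turns the hypothesis into \<open>norm g \<le> t\<close>.\<close>
  define t where "t = (norm z)\<^sup>2"
  have t: "t > 0" using False by (simp add: t_def)
  define g where "g = t *\<^sub>R 1 + star z * z"
  define G where "G = t *\<^sub>R 1 + z * star z"
  have ng: "norm g \<le> t"
    using assms by (simp add: psd_iff_norm cstar_identity g_def t_def)
  have sG: "star G = G" by (simp add: G_def star_add star_scaleR star_mult star_star)
  have Gz: "G ^ n * z = z * g ^ n" for n
  proof (induction n)
    case (Suc n)
    have "G ^ Suc n * z = G * (G ^ n * z)" by (simp add: mult.assoc)
    also have "\<dots> = (G * z) * g ^ n" by (simp add: Suc mult.assoc)
    also have "G * z = z * g" by (simp add: G_def g_def algebra_simps)
    finally show ?case by (simp add: mult.assoc)
  qed simp
  \<comment> \<open>By \<open>Gz\<close>, \<open>G ^ Suc n\<close> equals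
    \<open>t *\<^sub>R G ^ n\<close> plus \<open>z * g ^ n * star z\<close>, and the last term has
    norm at most \<open>t ^ Suc n\<close>. Relative to \<open>t ^ n\<close> the error thus grows
    only linearly.\<close>
  have D: "norm (G ^ n - t ^ n *\<^sub>R 1) \<le> real n * t ^ n" for n
  proof (induction n)
    case (Suc n)
    have "G ^ Suc n = G ^ n * G" by (simp add: power_commutes)
    also have "\<dots> = t *\<^sub>R G ^ n + (G ^ n * z) * star z" by (simp add: G_def algebra_simps)
    finally have "G ^ Suc n - t ^ Suc n *\<^sub>R 1 = t *\<^sub>R (G ^ n - t ^ n *\<^sub>R 1) + (z * g ^ n) * star z"
      unfolding Gz by (simp add: algebra_simps)
    then have "norm (G ^ Suc n - t ^ Suc n *\<^sub>R 1)
        \<le> norm (t *\<^sub>R (G ^ n - t ^ n *\<^sub>R 1)) + norm ((z * g ^ n) * star z)"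
      by (metis norm_triangle_ineq)
    moreover have "norm (t *\<^sub>R (G ^ n - t ^ n *\<^sub>R 1)) \<le> t * (real n * t ^ n)"
      using Suc t by simp
    moreover have "norm ((z * g ^ n) * star z) \<le> (norm z * t ^ n) * norm z"
    proof -
      have "norm (g ^ n) \<le> t ^ n"
        by (rule order_trans[OF norm_power_ineq]) (intro power_mono ng, simp)
      then have "norm (z * g ^ n) \<le> norm z * t ^ n"
        by (intro order_trans[OF norm_mult_ineq] mult_left_mono) auto
      then show ?thesis
        by (intro order_trans[OF norm_mult_ineq]) (simp add: mult_right_mono)
    qed
    moreover have "(norm z * t ^ n) * norm z = t * t ^ n"
      by (simp add: t_def power2_eq_square)
    moreover have "real (Suc n) * t ^ Suc n = t * (real n * t ^ n) + t * t ^ n"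
      by (simp add: algebra_simps)
    ultimately show ?case by linarith
  qed simp
  have "norm G / t \<le> 1"
  proof (rule le_1_if_power_le_linear)
    fix k :: nat
    have "norm (G ^ (2 ^ k)) \<le> norm (G ^ (2 ^ k) - t ^ (2 ^ k) *\<^sub>R 1) + norm (t ^ (2 ^ k) *\<^sub>R (1::'a))"
      by (metis norm_triangle_ineq diff_add_cancel)
    also have "\<dots> \<le> real (2 ^ k) * t ^ (2 ^ k) + t ^ (2 ^ k)"
      using D[of "2 ^ k"] t by (intro add_mono) auto
    finally have "norm G ^ (2 ^ k) \<le> (2 ^ k + 1) * t ^ (2 ^ k)"
      unfolding norm_power_two_power_sa[OF sG] by (simp add: algebra_simps)
    then show "(norm G / t) ^ (2 ^ k) \<le> 2 ^ k + 1"
      using t by (simp add: power_divide pos_divide_le_eq)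
  qed (use t in simp)
  then have "norm G \<le> t" using t by (simp add: field_simps)
  then show ?thesis unfolding psd_def G_def
    by (auto simp: star_minus star_mult star_star intro!: exI[of _ t])
qed simp

section \<open>Negative and positive parts, and positivity of \<open>star y * y\<close>\<close>

definition neg_part :: "'a::{cstar_algebra,real_normed_algebra_1} \<Rightarrow> 'a" where
  "neg_part h = (1/2) *\<^sub>R (psqrt (h * h) - h)"

text \<open>With \<open>m\<close> the absolute value and \<open>n\<close> the negative part,
  \<open>m * m = h * h\<close> gives \<open>n * m = n * n\<close>. So the cube of \<open>n\<close>
  equals \<open>n * m * n\<close>, the square of the self-adjoint \<open>n * c\<close> with
  \<open>c * c = m\<close>. Positivity of the cube suffices where \<open>n\<close> is to be shown
  zero.\<close>

lemma
  fixes h :: "'a::{cstar_algebra,real_normed_algebra_1}"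
  assumes sh: "star h = h"
  shows star_neg_part: "star (neg_part h) = neg_part h"
    and neg_part_commute: "c * h = h * c \<Longrightarrow> c * neg_part h = neg_part h * c"
    and neg_part_mult: "neg_part h * h = - (neg_part h * neg_part h)"
    and psd_neg_part_cube: "psd (neg_part h * neg_part h * neg_part h)"
    and psd_abs: "psd (h + 2 *\<^sub>R neg_part h)"
proof -
  define m where "m = psqrt (h * h)"
  have p: "psd (h * h)" using sh by (rule psd_square)
  have m: "psd m" "m * m = h * h" using p by (simp_all add: m_def psd_psqrt psqrt_square)
  define n where "n = (1/2) *\<^sub>R (m - h)"
  have n: "neg_part h = n" by (simp add: neg_part_def n_def m_def)
  have mc: "c * m = m * c" if "c * h = h * c" for c
    unfolding m_def
    by (intro psqrt_commute[OF p] commute_prod[symmetric]) (use that in simp_all)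
  have mh: "m * h = h * m" by (rule mc[symmetric]) simp
  show sn: "star (neg_part h) = neg_part h"
    unfolding n using sh psd_sa[OF m(1)] by (simp add: n_def star_scaleR star_diff)
  have "(m - h) * (m - h) = 2 *\<^sub>R (h * h - h * m)"
    using m(2) mh by (simp add: algebra_simps scaleR_2)
  then have nn: "n * n = (1/2) *\<^sub>R (h * h - h * m)" by (simp add: n_def)
  show "neg_part h * h = - (neg_part h * neg_part h)"
    unfolding n nn using mh by (simp add: n_def algebra_simps)
  have nm: "n * m = n * n" "m * n = n * n"
    unfolding nn using m(2) mh by (simp_all add: n_def algebra_simps)
  have "h + 2 *\<^sub>R n = m" by (simp add: n_def)
  then show "psd (h + 2 *\<^sub>R neg_part h)" unfolding n using m(1) by simp
  define c where "c = psqrt m"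
  have c: "psd c" "c * c = m" using m(1) by (simp_all add: c_def psd_psqrt psqrt_square)
  have nc: "n * c = c * n" unfolding c_def by (rule psqrt_commute[OF m(1)]) (simp add: nm)
  then have s: "star (n * c) = n * c"
    using sn[unfolded n] psd_sa[OF c(1)] by (simp add: star_mult)
  have "(n * c) * (n * c) = n * c * (c * n)" by (simp add: nc)
  then have "(n * c) * (n * c) = n * (c * c) * n" by (simp add: mult.assoc)
  then have "(n * c) * (n * c) = n * n * n" using c(2) nm by simp
  then show "psd (neg_part h * neg_part h * neg_part h)" unfolding n using psd_square[OF s] by simp
  show "c * neg_part h = neg_part h * c" if "c * h = h * c" for c
    unfolding n by (simp add: n_def right_diff_distrib left_diff_distrib mc[OF that] that)
qed

lemma cube_eq_0_sa:
  fixes n :: "'a::cstar_algebra"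
  assumes "star n = n" "n * n * n = 0"
  shows "n = 0"
proof -
  have "star (n * n) = n * n" using assms by (simp add: star_mult)
  moreover have "(n * n) * (n * n) = 0" using assms(2) by (simp flip: mult.assoc)
  ultimately show ?thesis using assms(1) square_eq_0_sa by metis
qed

text \<open>Let \<open>n\<close> be the negative part of \<open>h = star y * y\<close> and
  \<open>z = y * n\<close>. Then \<open>star z * z\<close> is minus the cube of \<open>n\<close>, so
  \<open>z * star z\<close> is negative too. But with \<open>z = u + i v\<close> the sum of both
  products is \<open>2 (u * u + v * v)\<close>, which is positive. Hence \<open>z * star z\<close>
  is also positive, so \<open>z = 0\<close>, \<open>n = 0\<close>, and \<open>h\<close> is its own
  absolute value.\<close>

lemma psd_star_mult_self:
  fixes y :: "'a::{cstar_algebra,real_normed_algebra_1}"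
  shows "psd (star y * y)"
proof -
  define h where "h = star y * y"
  have sh: "star h = h" by (simp add: h_def star_mult star_star)
  define n where "n = neg_part h"
  have n: "star n = n" "n * h = - (n * n)" "psd (n * n * n)" "psd (h + 2 *\<^sub>R n)"
    unfolding n_def using star_neg_part[OF sh] neg_part_mult[OF sh] psd_neg_part_cube[OF sh]
      psd_abs[OF sh] by blast+
  define z where "z = y * n"
  have "star z * z = n * h * n" using n(1) by (simp add: z_def h_def star_mult mult.assoc)
  then have zz: "star z * z = - (n * n * n)" using n(2) by simp
  then have m: "psd (- (z * star z))" using n(3) by (intro psd_minus_swap) simp
  define u where "u = (1/2) *\<^sub>R (z + star z)"
  define v where "v = (1/2) *\<^sub>R (\<i> *\<^sub>C (star z - z))"
  have su: "star u = u" by (simp add: u_def star_scaleR star_add star_star add.commute)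
  have sv: "star v = v"
    by (simp add: v_def star_scaleR star_scaleC star_diff star_star scaleC_minus_left
        scaleC_minus_right[symmetric])
  have "(\<i> *\<^sub>C w) * (\<i> *\<^sub>C w) = - (w * w)" for w :: 'a
    by (simp add: mult_scaleC_left mult_scaleC_right scaleC_scaleC scaleC_minus_left)
  then have "4 *\<^sub>R (v * v) = - ((star z - z) * (star z - z))" by (simp add: v_def)
  moreover have "4 *\<^sub>R (u * u) = (z + star z) * (z + star z)" by (simp add: u_def)
  ultimately have "4 *\<^sub>R (u * u + v * v) = 2 *\<^sub>R (star z * z + z * star z)"
    by (simp add: scaleR_add_right) (simp add: algebra_simps scaleR_2)
  then have "(1/2) *\<^sub>R (4 *\<^sub>R (u * u + v * v)) = star z * z + z * star z" by simp
  then have "star z * z + z * star z = 2 *\<^sub>R (u * u + v * v)" by simp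
  moreover have "psd (u * u + v * v)" using su sv psd_square psd_add by blast
  ultimately have "psd (star z * z + z * star z)" by (simp add: psd_scaleR)
  from psd_add[OF this n(3)] have "psd (z * star z)" using zz by simp
  with m have "z * star z = 0" using psd_antisym by blast
  then have "z = 0" by (simp add: mult_star_self_eq_0)
  then have "n * n * n = 0" using zz by simp
  then have "n = 0" using cube_eq_0_sa n(1) by blast
  then show ?thesis using n(4) by (simp add: h_def)
qed

lemma psd_conj:
  assumes "psd h"
  shows "psd (star c * h * c)"
proof -
  define q where "q = psqrt h"
  have q: "psd q" "q * q = h" using assms by (simp_all add: q_def psd_psqrt psqrt_square)
  have "star (q * c) * (q * c) = star c * h * c"
    using q by (simp add: star_mult psd_sa mult.assoc flip: q(2))
  then show ?thesis using psd_star_mult_self[of "q * c"] by simp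
qed

text \<open>Let \<open>k\<close> be the negative part of \<open>a = h + n\<close>. Since
  \<open>a * n = 0\<close>, also \<open>k * n = 0\<close>, and conjugating the absolute value
  \<open>a + n\<close> by \<open>k\<close> leaves minus the cube of \<open>k\<close>. This is
  positive, so \<open>k = 0\<close>.\<close>

lemma psd_pos_part:
  fixes h :: "'a::{cstar_algebra,real_normed_algebra_1}"
  assumes sh: "star h = h"
  shows "psd (h + neg_part h)"
proof -
  define n where "n = neg_part h"
  define a where "a = h + n"
  have n: "star n = n" "h * n = n * h" "n * h = - (n * n)" "psd (h + 2 *\<^sub>R n)"
    unfolding n_def using star_neg_part[OF sh] neg_part_commute[OF sh refl] neg_part_mult[OF sh]
      psd_abs[OF sh] by blast+
  have sa: "star a = a" using sh n(1) by (simp add: a_def star_add)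
  have an: "a * n = 0" "n * a = 0" using n(2,3) by (simp_all add: a_def algebra_simps)
  define k where "k = neg_part a"
  have k: "star k = k" "k * a = - (k * k)" "psd (k * k * k)" "psd (a + 2 *\<^sub>R k)"
    unfolding k_def using star_neg_part[OF sa] neg_part_mult[OF sa] psd_neg_part_cube[OF sa]
      psd_abs[OF sa] by blast+
  have nk: "n * k = k * n" unfolding k_def by (rule neg_part_commute[OF sa]) (simp add: an)
  have "k * k * n = - (k * (a * n))" using k(2) by (simp flip: mult.assoc)
  then have "k * k * n * n = 0" using an by simp
  moreover have "(k * n) * (k * n) = k * (n * k) * n" by (simp add: mult.assoc)
  ultimately have "(k * n) * (k * n) = 0" by (simp add: nk mult.assoc)
  moreover have "star (k * n) = k * n" using k(1) n(1) nk by (simp add: star_mult)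
  ultimately have kn: "k * n = 0" using square_eq_0_sa by blast
  have "star k * (h + 2 *\<^sub>R n) * k = k * (a + n) * k"
    using k(1) by (simp add: a_def scaleR_2 add.assoc)
  also have "\<dots> = - (k * k * k)" using k(2) kn by (simp add: algebra_simps)
  finally have "psd (- (k * k * k))" using psd_conj[OF n(4), of k] by simp
  then have "k * k * k = 0" using psd_antisym k(3) by blast
  then have "k = 0" using cube_eq_0_sa k(1) by blast
  then show ?thesis using k(4) by (simp add: a_def n_def)
qed

section \<open>Inverses and local units\<close>

lemma invertible_add_psd:
  fixes a :: "'a::{cstar_algebra,real_normed_algebra_1}"
  assumes a: "psd a" and e: "0 < e"
  shows "\<exists>g. g * (e *\<^sub>R 1 + a) = 1 \<and> (e *\<^sub>R 1 + a) * g = 1"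
proof -
  define t where "t = e + norm a"
  have t: "t > 0" using e by (simp add: t_def add_pos_nonneg)
  define w where "w = e *\<^sub>R 1 + a"
  \<comment> \<open>This makes \<open>w = t *\<^sub>R (1 - r)\<close> with
    \<open>norm r < 1\<close>, so a Neumann series inverts it.\<close>
  define r where "r = (1 / t) *\<^sub>R (norm a *\<^sub>R 1 - a)"
  have "t *\<^sub>R 1 - w = norm a *\<^sub>R 1 - a" by (simp add: w_def t_def algebra_simps)
  then have w: "w = t *\<^sub>R (1 - r)" using t by (simp add: r_def algebra_simps)
  have "norm (norm a *\<^sub>R 1 - a) \<le> norm a" using a by (simp add: psd_iff_norm)
  then have "norm r \<le> norm a / t" using t by (simp add: r_def divide_right_mono)
  also have "\<dots> < 1" using t e by (simp add: t_def)
  finally have s: "summable (\<lambda>n. r ^ n)" by (rule complete_algebra_summable_geometric)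
  define G where "G = (\<Sum>n. r ^ n)"
  have split: "G = 1 + (\<Sum>n. r ^ Suc n)"
    using suminf_split_head[OF s] by (simp add: G_def)
  have "(\<Sum>n. r ^ Suc n) = r * G" using suminf_mult[OF s, of r] by (simp add: G_def)
  then have 1: "(1 - r) * G = 1" using split by (simp add: left_diff_distrib)
  have "(\<Sum>n. r ^ Suc n) = G * r"
    using suminf_mult2[OF s, of r] by (simp add: G_def power_commutes)
  then have 2: "G * (1 - r) = 1" using split by (simp add: right_diff_distrib)
  show ?thesis
    by (rule exI[of _ "(1 / t) *\<^sub>R G"]) (use 1 2 t in \<open>simp add: w[unfolded w_def]\<close>)
qed

text \<open>With \<open>a = (x - \<epsilon>)\<^sub>+\<close> and \<open>s = (\<epsilon> + a) powr (- 1/2)\<close>, the element \<open>s * s * x\<close>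
  is \<open>min (x / \<epsilon>) 1\<close>, which acts as a unit on \<open>x * a\<close>.\<close>

lemma local_unit_exists:
  fixes x :: "'a::{cstar_algebra,real_normed_algebra_1}"
  assumes x: "psd x" and x0: "x \<noteq> 0"
  shows "\<exists>a s c. star s = s \<and> s * x = x * s \<and> (s * s * x) * (x * a) = x * a \<and>
    (x * a) * (s * s * x) = x * a \<and> x * a \<noteq> 0 \<and> 0 \<le> c \<and> psd (c *\<^sub>R x - s * s * x)"
proof -
  \<comment> \<open>The level must be positive to make \<open>w\<close> invertible and below
    \<open>norm x\<close> to make \<open>a\<close> non-zero; half of the norm is a convenient
    choice.\<close>
  define e where "e = norm x / 2"
  have e: "e > 0" using x0 by (simp add: e_def)
  define h where "h = x - e *\<^sub>R 1"
  have sh: "star h = h" using psd_sa[OF x] by (simp add: h_def star_diff star_scaleR)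
  define n where "n = neg_part h"
  define a where "a = h + n"
  have n: "star n = n" "h * n = n * h" "n * h = - (n * n)" "psd (h + 2 *\<^sub>R n)"
    unfolding n_def using star_neg_part[OF sh] neg_part_commute[OF sh refl] neg_part_mult[OF sh]
      psd_abs[OF sh] by blast+
  have a: "psd a" unfolding a_def n_def by (rule psd_pos_part[OF sh])
  have na: "n * a = 0" using n(2,3) by (simp add: a_def algebra_simps)
  have xe: "x = e *\<^sub>R 1 + a - n" by (simp add: a_def h_def)
  define w where "w = e *\<^sub>R 1 + a"
  have an: "a * n = 0" using n(2,3) by (simp add: a_def algebra_simps)
  \<comment> \<open>Because \<open>a\<close> and \<open>n\<close> annihilate each other, next to
    \<open>a\<close> the element \<open>x\<close> acts as the invertible \<open>w\<close>.\<close>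
  have xa: "x * a = w * a" and ax: "a * x = a * w"
    unfolding xe w_def using na an by (simp_all add: algebra_simps)
  have wa: "w * a = a * w" by (simp add: w_def algebra_simps)
  obtain g where g: "g * w = 1" "w * g = 1"
    using invertible_add_psd[OF a e] unfolding w_def by blast
  have gc: "c * g = g * c" if "c * a = a * c" for c
  proof -
    have cw: "c * w = w * c" using that by (simp add: w_def algebra_simps)
    have "c * g = (g * w) * (c * g)" using g by simp
    also have "\<dots> = g * (c * w) * g" by (simp add: cw mult.assoc)
    also have "\<dots> = (g * c) * (w * g)" by (simp add: mult.assoc)
    finally show ?thesis using g by simp
  qed
  have sw: "star w = w" using psd_sa[OF a] by (simp add: w_def star_add star_scaleR)
  have "star g = star g * (w * g)" using g by simp
  also have "\<dots> = star (w * g) * g" using sw by (simp add: star_mult mult.assoc)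
  finally have sg: "star g = g" using g by simp
  have "psd (e *\<^sub>R (1::'a))" using e by (auto simp: psd_def star_scaleR intro!: exI[of _ e])
  then have "psd w" unfolding w_def using a by (rule psd_add)
  from psd_conj[OF this, of g] have pg: "psd g" using sg g by simp
  define s where "s = psqrt g"
  have s: "psd s" "s * s = g" using pg by (simp_all add: s_def psd_psqrt psqrt_square)
  have sc: "c * s = s * c" if "c * a = a * c" for c
    unfolding s_def by (rule psqrt_commute[OF pg gc[OF that]])
  have xac: "x * a = a * x" using xa ax wa by simp
  have gx: "x * g = g * x" by (rule gc[OF xac])
  have ga: "a * g = g * a" by (rule gc) simp
  have "(s * s * x) * (x * a) = g * x * (w * a)" by (simp add: s xa)
  also have "\<dots> = x * (g * w) * a" by (simp add: gx[symmetric] mult.assoc)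
  finally have 1: "(s * s * x) * (x * a) = x * a" using g by simp
  have "(x * a) * (s * s * x) = x * (a * g) * x" by (simp add: s mult.assoc)
  also have "\<dots> = (x * g) * (a * x)" by (simp add: ga mult.assoc)
  also have "\<dots> = (s * s * x) * (x * a)" by (simp add: gx s xac)
  finally have 2: "(x * a) * (s * s * x) = x * a" using 1 by simp
  have "a \<noteq> 0"
  proof
    assume "a = 0"
    then have hn: "h = - n" by (simp add: a_def eq_neg_iff_add_eq_0)
    then have "psd n" using n(4) by (simp add: scaleR_2)
    moreover have "n = e *\<^sub>R 1 - x" using hn by (simp add: h_def algebra_simps)
    ultimately have "norm x \<le> \<bar>e\<bar>" using norm_le_if_psd[OF x] by simp
    then show False using e by (simp add: e_def)
  qed
  have 3: "x * a \<noteq> 0"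
  proof
    assume "x * a = 0"
    then have "e *\<^sub>R a + a * a = 0" using xa by (simp add: w_def distrib_right)
    then have "e *\<^sub>R a = - (a * a)" by (simp add: eq_neg_iff_add_eq_0)
    then have "psd (- (a * a))" using psd_scaleR[OF a, of e] e by simp
    then have "a * a = 0" using psd_square[OF psd_sa[OF a]] psd_antisym by blast
    then show False using square_eq_0_sa[OF psd_sa[OF a]] \<open>a \<noteq> 0\<close> by simp
  qed
  \<comment> \<open>Conjugating \<open>norm g *\<^sub>R 1 - g\<close> by a root of \<open>x\<close>
    yields the bound with \<open>c = norm g\<close>.\<close>
  define q where "q = psqrt x"
  have q: "psd q" "q * q = x" using x by (simp_all add: q_def psd_psqrt psqrt_square)
  have qg: "g * q = q * g" unfolding q_def by (rule psqrt_commute[OF x gx[symmetric]])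
  have "star q * (norm g *\<^sub>R 1 - g) * q = norm g *\<^sub>R (q * q) - q * (g * q)"
    using psd_sa[OF q(1)] by (simp add: algebra_simps)
  also have "\<dots> = norm g *\<^sub>R x - s * s * x"
    unfolding qg s using gx by (simp add: q(2) flip: mult.assoc)
  finally have 4: "psd (norm g *\<^sub>R x - s * s * x)"
    using psd_conj[OF psd_norm_minus[OF sg], of q] by simp
  show ?thesis
    using psd_sa[OF s(1)] sc[OF xac] 1 2 3 4 by (metis norm_ge_zero)
qed

section \<open>Positive elements of a C*-algebra\<close>

definition pos :: "'a::cstar_algebra \<Rightarrow> bool" where
  "pos a \<longleftrightarrow> psd (emb a)"

lemma pos_sa: "pos a \<Longrightarrow> star a = a"
  using psd_sa[of "emb a"] by (simp add: pos_def flip: emb_simps)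

lemma pos_0 [simp]: "pos 0"
  by (simp add: pos_def emb_simps)

lemma pos_add: "pos a \<Longrightarrow> pos b \<Longrightarrow> pos (a + b)"
  by (simp add: pos_def emb_simps psd_add)

lemma pos_scaleR: "pos a \<Longrightarrow> 0 \<le> c \<Longrightarrow> pos (c *\<^sub>R a)"
  by (simp add: pos_def emb_simps psd_scaleR)

lemma pos_star_mult_self: "pos (star y * y)"
  using psd_star_mult_self[of "emb y"] by (simp add: pos_def emb_simps)

lemma pos_mult_star_self: "pos (y * star y)"
  using pos_star_mult_self[of "star y"] by (simp add: star_star)

text \<open>Conjugation of \<open>- norm h \<le> h \<le> norm h\<close> by \<open>c\<close>; the
  unit occurs only in the unitization and disappears in the product.\<close>

lemma pos_norm_conj:
  assumes "star h = h"
  shows "pos (norm h *\<^sub>R (star c * c) - star c * h * c)"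
    and "pos (norm h *\<^sub>R (star c * c) + star c * h * c)"
proof -
  have sh: "star (emb h) = emb h" using assms by (simp flip: emb_simps)
  show "pos (norm h *\<^sub>R (star c * c) - star c * h * c)"
    using psd_conj[OF psd_norm_minus[OF sh], of "emb c"]
    by (simp add: pos_def emb_simps algebra_simps)
  show "pos (norm h *\<^sub>R (star c * c) + star c * h * c)"
    using psd_conj[OF psd_norm_plus[OF sh], of "emb c"]
    by (simp add: pos_def emb_simps algebra_simps)
qed

lemma closed_pos: "closed {a. pos a}"
proof -
  have "closed (emb -` {h. psd h})"
    by (intro continuous_closed_vimage closed_psd linear_continuous_at bounded_linear_emb)
  then show ?thesis by (simp add: pos_def vimage_def)
qed

lemma subalgebra_scaleR: "complex_subspace B \<Longrightarrow> x \<in> B \<Longrightarrow> r *\<^sub>R x \<in> B"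
  unfolding complex_subspace_def by (metis scaleC_of_real)

lemma subalgebra_diff: "complex_subspace B \<Longrightarrow> x \<in> B \<Longrightarrow> y \<in> B \<Longrightarrow> x - y \<in> B"
  using subalgebra_scaleR[of B y "- 1"] unfolding complex_subspace_def
  by (metis add_uminus_conv_diff scaleR_minus1_left)

lemma closed_real_algebra_unitization:
  assumes "cstar_subalgebra B"
  shows "closed_real_algebra {u. uvec u \<in> B}"
proof -
  have "closed B" using assms by (simp add: cstar_subalgebra_def)
  then have "closed (uvec -` B)"
    by (intro continuous_closed_vimage linear_continuous_at bounded_linear_uvec)
  then show ?thesis
    using assms subalgebra_scaleR[of B]
    by (auto simp: closed_real_algebra_def vimage_def cstar_subalgebra_def complex_subspace_def)
qed

lemma cstar_subalgebra_UNIV: "cstar_subalgebra UNIV"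
  by (simp add: cstar_subalgebra_def complex_subspace_def)

lemma pos_sqrt_in:
  assumes B: "cstar_subalgebra B" and a: "pos a" "a \<in> B"
  shows "\<exists>r\<in>B. star r = r \<and> r * r = a"
proof -
  have p: "psd (emb a)" using a by (simp add: pos_def)
  define q where "q = psqrt (emb a)"
  have q: "star q = q" "q * q = emb a"
    using psd_sa[OF psd_psqrt[OF p]] psqrt_square[OF p] by (simp_all add: q_def)
  have 0: "0 \<in> B" using B by (simp add: cstar_subalgebra_def complex_subspace_def)
  have "q \<in> {u. uvec u \<in> B}"
    unfolding q_def by (rule psqrt_in[OF p closed_real_algebra_unitization[OF B]])
      (use a 0 in auto)
  \<comment> \<open>So far \<open>q\<close> is known to lie in \<open>B\<close> up to a scalar; the
    scalar vanishes because its square does.\<close>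
  moreover have "uscal q * uscal q = 0" using arg_cong[OF q(2), of uscal] by simp
  then have "emb (uvec q) = q" by (intro emb_uvec) simp
  then have "emb (star (uvec q)) = emb (uvec q)" "emb (uvec q * uvec q) = emb a"
    using q by (simp_all add: emb_simps)
  then have "star (uvec q) = uvec q" "uvec q * uvec q = a" by simp_all
  ultimately show ?thesis by blast
qed

lemma pos_cone_eq:
  assumes B: "cstar_subalgebra B"
  shows "pos_cone B = {a\<in>B. pos a}"
proof
  show "pos_cone B \<subseteq> {a\<in>B. pos a}"
    using B by (auto simp: pos_cone_def pos_star_mult_self cstar_subalgebra_def)
  show "{a\<in>B. pos a} \<subseteq> pos_cone B"
    using pos_sqrt_in[OF B] unfolding pos_cone_def by (auto, metis)
qed

lemma pos_cone_UNIV: "pos_cone UNIV = {a. pos a}"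
  using pos_cone_eq[OF cstar_subalgebra_UNIV] by simp

lemma dominates_UNIV: "dominates UNIV b a \<longleftrightarrow> pos b \<and> pos a \<and> pos (b - a)"
  by (simp add: dominates_def pos_cone_UNIV)

section \<open>Corners\<close>

text \<open>Here \<open>e\<close> is typically not a projection but a cut-off function such as
  \<open>v * star v\<close>; the members are supported where that function equals 1.\<close>

definition corner :: "'a::cstar_algebra \<Rightarrow> 'a set" where
  "corner e = {b. e * b = b \<and> b * e = b}"

text \<open>With \<open>u = 1 - e\<close> in the unitization, \<open>b * u = 0\<close>, so
  conjugating \<open>b - a\<close> by \<open>u\<close> shows that \<open>u * a * u\<close> is
  negative as well as positive. It vanishes, hence so do a root of \<open>a\<close> times
  \<open>u\<close>, and \<open>a * u\<close>.\<close>

lemma corner_dominated: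
  assumes se: "star e = e" and b: "b * e = b" and ab: "pos a" "pos (b - a)"
  shows "a \<in> corner e"
proof -
  define u where "u = 1 - emb e"
  have su: "star u = u" using se by (simp add: u_def star_diff flip: emb_simps)
  have "emb b * u = 0" using b by (simp add: u_def algebra_simps flip: emb_simps)
  then have "star u * emb (b - a) * u = - (star u * emb a * u)"
    by (simp add: emb_simps algebra_simps)
  then have "psd (- (star u * emb a * u))" using psd_conj[of "emb (b - a)" u] ab by (simp add: pos_def)
  moreover have p: "psd (emb a)" using ab by (simp add: pos_def)
  ultimately have z: "star u * emb a * u = 0" using psd_conj[OF p, of u] psd_antisym by blast
  define q where "q = psqrt (emb a)"
  have q: "star q = q" "q * q = emb a"
    using psd_sa[OF psd_psqrt[OF p]] psqrt_square[OF p] by (simp_all add: q_def)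
  have "star (q * u) * (q * u) = star u * (q * q) * u" by (simp add: star_mult q(1) mult.assoc)
  then have "q * u = 0" using z q(2) star_mult_self_eq_0 by metis
  then have "emb a * u = 0" using q(2) by (metis mult.assoc mult_zero_right)
  then have "emb (a * e) = emb a" by (simp add: u_def algebra_simps emb_simps)
  then have 1: "a * e = a" by simp
  then have "star (a * e) = star a" by simp
  then have "e * a = a" using se pos_sa[OF ab(1)] by (simp add: star_mult)
  with 1 show ?thesis by (simp add: corner_def)
qed

lemma cstar_subalgebra_corner:
  assumes "star e = e"
  shows "cstar_subalgebra (corner e)"
proof -
  have "closed (corner e)" unfolding corner_def
    by (intro closed_Collect_conj closed_Collect_eq continuous_intros)
  moreover have "star x \<in> corner e" if "x \<in> corner e" for x
  proof -
    have "star (e * x) = star x" "star (x * e) = star x" using that by (simp_all add: corner_def)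
    then show ?thesis using assms by (simp add: corner_def star_mult)
  qed
  moreover have "x * y \<in> corner e" if "x \<in> corner e" "y \<in> corner e" for x y
  proof -
    have "e * (x * y) = (e * x) * y" "(x * y) * e = x * (y * e)" by (simp_all add: mult.assoc)
    then show ?thesis using that by (simp add: corner_def)
  qed
  ultimately show ?thesis
    by (auto simp: cstar_subalgebra_def complex_subspace_def)
      (auto simp: corner_def distrib_left distrib_right mult_scaleC_left mult_scaleC_right)
qed

lemma hereditary_corner:
  assumes "star e = e"
  shows "hereditary_subalgebra (corner e)"
  unfolding hereditary_subalgebra_def
proof (intro conjI ballI allI impI)
  show "cstar_subalgebra (corner e)" by (rule cstar_subalgebra_corner[OF assms])
  fix b a assume "b \<in> pos_cone (corner e)" "dominates UNIV b a"
  then show "a \<in> corner e"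
    using corner_dominated[OF assms, of b a]
    by (simp add: pos_cone_eq[OF cstar_subalgebra_corner[OF assms]] dominates_UNIV)
      (simp add: corner_def)
qed

lemma corner_mult_mult:
  assumes "b \<in> corner e" "b' \<in> corner e"
  shows "b * a * b' \<in> corner e"
proof -
  have "e * (b * a * b') = (e * b) * a * b'" "(b * a * b') * e = b * a * (b' * e)"
    by (simp_all add: mult.assoc)
  then show ?thesis using assms by (simp add: corner_def)
qed

text \<open>The clauses serve different ends: the second puts the corner into every ideal containing
  \<open>z * star z\<close>, the third maps it into \<open>star z A z\<close>, and the last bounds
  its positive elements through \<open>corner_pos_dominated\<close>.\<close>

lemma corner_exists:
  fixes z :: "'a::cstar_algebra"
  assumes "z \<noteq> 0"
  shows "\<exists>v c. corner (v * star v) \<noteq> {0} \<and>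
    (\<forall>b\<in>corner (v * star v). \<exists>b'. b = (z * star z) * b' * (z * star z)) \<and>
    (\<forall>b. \<exists>b'. star v * b * v = star z * b' * z) \<and>
    0 \<le> c \<and> pos (c *\<^sub>R (z * star z) - v * star v)"
proof -
  define x where "x = emb (z * star z)"
  have x: "psd x" using pos_mult_star_self[of z] by (simp add: x_def pos_def)
  have x0: "x \<noteq> 0"
    using assms by (simp add: x_def mult_star_self_eq_0 flip: emb_simps(7))
  obtain a s c where s: "star s = s" "s * x = x * s" "(s * s * x) * (x * a) = x * a"
    "(x * a) * (s * s * x) = x * a" "x * a \<noteq> 0" "0 \<le> c" "psd (c *\<^sub>R x - s * s * x)"
    using local_unit_exists[OF x x0] by blast
  \<comment> \<open>\<open>s\<close> lives only in the unitization, but its product with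
    \<open>emb z\<close> has scalar part zero.\<close>
  define v where "v = uvec (s * emb z)"
  have v: "emb v = s * emb z" unfolding v_def by (rule emb_uvec) simp
  have f: "emb (v * star v) = s * s * x"
  proof -
    have "emb (v * star v) = s * x * s"
      by (simp add: emb_simps v x_def star_mult s(1) mult.assoc)
    also have "\<dots> = s * (x * s)" by (simp add: mult.assoc)
    also have "\<dots> = s * s * x" by (simp add: mult.assoc flip: s(2))
    finally show ?thesis .
  qed
  define d where "d = uvec (x * a)"
  have d: "emb d = x * a" unfolding d_def by (rule emb_uvec) (simp add: x_def)
  have "d \<noteq> 0" using s(5) d by (auto simp: emb_simps)
  moreover have "emb (v * star v * d) = emb d" "emb (d * (v * star v)) = emb d"
    using s(3,4) by (simp_all only: emb_simps(3)[of _ d] emb_simps(3)[of d] f d)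
  then have "d \<in> corner (v * star v)" by (simp add: corner_def)
  ultimately have 1: "corner (v * star v) \<noteq> {0}" by blast
  have 2: "\<exists>b'. b = (z * star z) * b' * (z * star z)" if b: "b \<in> corner (v * star v)" for b
  proof -
    have "b = (v * star v) * b * (v * star v)" using b by (simp add: corner_def)
    then have "emb b = emb ((v * star v) * b * (v * star v))" by simp
    also have "\<dots> = (s * s * x) * emb b * (s * s * x)" by (simp only: emb_simps(3)[of _ "v * star v"] emb_simps(3)[of _ b] f)
    also have "s * s * x = x * (s * s)" using s(2) by (metis mult.assoc)
    finally have "emb b = (x * (s * s)) * emb b * (s * s * x)"
      using s(2) by (metis mult.assoc)
    also have "\<dots> = x * (s * s * emb b * (s * s)) * x" by (simp add: mult.assoc)
    also have "s * s * emb b * (s * s) = emb (uvec (s * s * emb b * (s * s)))"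
      by (rule emb_uvec[symmetric]) simp
    finally have "emb b = emb ((z * star z) * uvec (s * s * emb b * (s * s)) * (z * star z))"
      by (simp add: x_def emb_simps)
    then show ?thesis unfolding emb_eq_iff by (rule exI)
  qed
  have 3: "\<exists>b'. star v * b * v = star z * b' * z" for b
  proof -
    have "emb (star v * b * v) = star (emb z) * (s * emb b * s) * emb z"
      by (simp add: emb_simps v star_mult s(1) mult.assoc)
    also have "s * emb b * s = emb (uvec (s * emb b * s))"
      by (rule emb_uvec[symmetric]) simp
    finally have "emb (star v * b * v) = emb (star z * uvec (s * emb b * s) * z)"
      by (simp add: emb_simps)
    then show ?thesis unfolding emb_eq_iff by (rule exI)
  qed
  have 4: "pos (c *\<^sub>R (z * star z) - v * star v)"
    using s(7) by (simp only: pos_def emb_simps(2,5) f x_def)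
  show ?thesis using 1 2 3 4 s(6) by blast
qed

text \<open>For \<open>h = star v * b * v\<close> the corner equations give
  \<open>b = v * h * star v\<close>, which is at most \<open>norm h\<close> times
  \<open>v * star v\<close>.\<close>

lemma corner_pos_dominated:
  assumes b: "b \<in> corner (v * star v)" "pos b"
    and c: "0 \<le> c" "pos (c *\<^sub>R (z * star z) - v * star v)"
  shows "\<exists>C>0. pos (C *\<^sub>R (z * star z) - b)"
proof -
  define h where "h = star v * b * v"
  have sh: "star h = h" using pos_sa[OF b(2)] by (simp add: h_def star_mult star_star mult.assoc)
  have vhv: "v * h * star v = b"
  proof -
    have "v * h * star v = (v * star v) * b * (v * star v)" by (simp add: h_def mult.assoc)
    then show ?thesis using b(1) by (simp add: corner_def)
  qed
  have 1: "pos (norm h *\<^sub>R (v * star v) - b)"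
    using pos_norm_conj(1)[OF sh, of "star v"] by (simp add: star_star vhv)
  have 2: "pos (norm h *\<^sub>R (c *\<^sub>R (z * star z) - v * star v))" using c by (intro pos_scaleR) auto
  \<comment> \<open>The extra summand \<open>z * star z\<close> only serves to make the constant
    strictly positive.\<close>
  have "(norm h * c + 1) *\<^sub>R (z * star z) - b = (norm h *\<^sub>R (v * star v) - b)
      + norm h *\<^sub>R (c *\<^sub>R (z * star z) - v * star v) + z * star z"
    by (simp add: algebra_simps)
  then have "pos ((norm h * c + 1) *\<^sub>R (z * star z) - b)"
    using pos_add[OF pos_add[OF 1 2] pos_mult_star_self[of z]] by (simp only:)
  moreover have "norm h * c + 1 > 0" using c by (simp add: add_nonneg_pos)
  ultimately show ?thesis by blast
qed

text \<open>For self-adjoint \<open>k\<close>, the element \<open>v * k * star v\<close> shifted by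
  \<open>norm k\<close> times \<open>v * star v\<close> lies between 0 and twice that multiple, so
  heredity applies. Real and imaginary parts give the general case.\<close>

lemma hereditary_conj:
  assumes B: "hereditary_subalgebra B" and v: "v * star v \<in> B"
  shows "v * h * star v \<in> B"
proof -
  have BS: "cstar_subalgebra B" and cs: "complex_subspace B"
    using B by (simp_all add: hereditary_subalgebra_def cstar_subalgebra_def)
  have sa: "v * k * star v \<in> B" if k: "star k = k" for k
  proof -
    define p where "p = norm k *\<^sub>R (v * star v) + v * k * star v"
    have p: "pos p" using pos_norm_conj(2)[OF k, of "star v"] by (simp add: p_def star_star)
    have "(2 * norm k) *\<^sub>R (v * star v) = norm k *\<^sub>R (v * star v) + norm k *\<^sub>R (v * star v)"
      by (simp flip: scaleR_add_left)
    then have "pos ((2 * norm k) *\<^sub>R (v * star v) - p)"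
      using pos_norm_conj(1)[OF k, of "star v"] by (simp add: p_def star_star)
    moreover have "pos ((2 * norm k) *\<^sub>R (v * star v))"
      by (intro pos_scaleR pos_mult_star_self) simp
    ultimately have "p \<in> B"
      using B subalgebra_scaleR[OF cs v, of "2 * norm k"] p
      unfolding hereditary_subalgebra_def pos_cone_eq[OF BS] dominates_UNIV by blast
    then have "p - norm k *\<^sub>R (v * star v) \<in> B"
      using subalgebra_diff[OF cs] subalgebra_scaleR[OF cs v] by blast
    then show ?thesis by (simp add: p_def)
  qed
  define h1 where "h1 = (1/2) *\<^sub>R (h + star h)"
  define h2 where "h2 = (1/2) *\<^sub>R (\<i> *\<^sub>C (star h - h))"
  have "star h1 = h1" by (simp add: h1_def star_scaleR star_add star_star add.commute)
  moreover have "star h2 = h2"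
    by (simp add: h2_def star_scaleR star_scaleC star_diff star_star scaleC_minus_left
        scaleC_minus_right[symmetric])
  moreover have "v * h * star v = v * h1 * star v + \<i> *\<^sub>C (v * h2 * star v)"
  proof -
    have "\<i> *\<^sub>C h2 = (1/2) *\<^sub>R (h - star h)"
      by (simp add: h2_def scaleC_scaleR scaleC_scaleC scaleC_minus_left algebra_simps)
    moreover have "h1 + (1/2) *\<^sub>R (h - star h) = (1/2) *\<^sub>R (h + h)"
      by (simp only: h1_def flip: scaleR_add_right) simp
    ultimately have "h = h1 + \<i> *\<^sub>C h2" by simp
    then have "v * h * star v = v * (h1 + \<i> *\<^sub>C h2) * star v" by (rule arg_cong)
    then show ?thesis
      by (simp only: distrib_left distrib_right mult_scaleC_left mult_scaleC_right)
  qed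
  ultimately show ?thesis using sa cs unfolding complex_subspace_def by simp
qed

lemma hereditary_contains_corner:
  assumes B: "hereditary_subalgebra B" and B0: "B \<noteq> {0}"
  shows "\<exists>e. star e = e \<and> corner e \<noteq> {0} \<and> corner e \<subseteq> B"
proof -
  have BS: "cstar_subalgebra B" and cs: "complex_subspace B"
    using B by (simp_all add: hereditary_subalgebra_def cstar_subalgebra_def)
  obtain z where z: "z \<in> B" "z \<noteq> 0"
    using B0 cs by (auto simp: complex_subspace_def)
  then have zz: "z * star z \<in> B" using BS by (simp add: cstar_subalgebra_def)
  obtain v c where v: "corner (v * star v) \<noteq> {0}" "0 \<le> c" "pos (c *\<^sub>R (z * star z) - v * star v)"
    using corner_exists[OF z(2)] by blast
  have "pos (c *\<^sub>R (z * star z))" using v(2) by (intro pos_scaleR pos_mult_star_self)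
  then have "v * star v \<in> B"
    using B v(3) subalgebra_scaleR[OF cs zz, of c] pos_mult_star_self[of v]
    unfolding hereditary_subalgebra_def pos_cone_eq[OF BS] dominates_UNIV by blast
  note conj = hereditary_conj[OF B this]
  have "corner (v * star v) \<subseteq> B"
  proof
    fix b assume b: "b \<in> corner (v * star v)"
    have "b = (v * star v) * b * (v * star v)" using b by (simp add: corner_def)
    then have "b = v * (star v * b * v) * star v" by (simp add: mult.assoc)
    then show "b \<in> B" using conj by metis
  qed
  then show ?thesis using v(1) by (intro exI[of _ "v * star v"]) (simp add: star_mult star_star)
qed

lemma nonzero_member:
  assumes "0 \<in> B" "B \<noteq> {0}"
  obtains b where "b \<in> B" "b \<noteq> 0"
  using assms by blast

lemma corner_0 [simp]: "0 \<in> corner e"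
  by (simp add: corner_def)

lemma corner_star_mult_self:
  assumes "star e = e" "b \<in> corner e"
  shows "star b * b \<in> corner e"
  using cstar_subalgebra_corner[OF assms(1)] assms(2) by (simp add: cstar_subalgebra_def)

lemma corner_pos_exists:
  assumes "star e = e" "corner e \<noteq> {0}"
  obtains d where "d \<in> corner e" "pos d" "d \<noteq> 0"
proof -
  obtain b where "b \<in> corner e" "b \<noteq> 0" using nonzero_member[OF corner_0 assms(2)] .
  then show thesis
    by (intro that[of "star b * b"] corner_star_mult_self[OF assms(1)] pos_star_mult_self)
      (simp_all add: star_mult_self_eq_0)
qed

lemma corner_below:
  assumes y: "pos y" "y \<noteq> 0"
  obtains e where "star e = e" "corner e \<noteq> {0}" "\<forall>b\<in>corner e. \<exists>a. b = y * a * y"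
    "\<forall>b\<in>corner e. pos b \<longrightarrow> (\<exists>C>0. pos (C *\<^sub>R y - b))"
proof -
  \<comment> \<open>Writing \<open>y = r * star r\<close> makes \<open>corner_exists\<close>
    applicable with \<open>z = r\<close>.\<close>
  obtain r where r: "star r = r" "r * r = y"
    using pos_sqrt_in[OF cstar_subalgebra_UNIV y(1)] by auto
  then have "r \<noteq> 0" using y(2) by auto
  then obtain v c where v: "corner (v * star v) \<noteq> {0}"
    "\<forall>b\<in>corner (v * star v). \<exists>b'. b = (r * star r) * b' * (r * star r)"
    "0 \<le> c" "pos (c *\<^sub>R (r * star r) - v * star v)"
    using corner_exists[of r] by blast
  have ry: "r * star r = y" using r by simp
  show thesis
  proof (rule that[of "v * star v"])
    show "star (v * star v) = v * star v" by (simp add: star_mult star_star)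
    show "corner (v * star v) \<noteq> {0}" by (fact v(1))
    show "\<forall>b\<in>corner (v * star v). \<exists>a. b = y * a * y"
      using v(2) unfolding ry .
    show "\<forall>b\<in>corner (v * star v). pos b \<longrightarrow> (\<exists>C>0. pos (C *\<^sub>R y - b))"
      using corner_pos_dominated[OF _ _ v(3,4)] unfolding ry by blast
  qed
qed

section \<open>Abelian and finite elements versus corners\<close>

lemma pos_cone_mono: "B \<subseteq> B' \<Longrightarrow> pos_cone B \<subseteq> pos_cone B'"
  by (auto simp: pos_cone_def)

lemma pos_cone_corner: "star e = e \<Longrightarrow> pos_cone (corner e) = {a\<in>corner e. pos a}"
  by (simp add: pos_cone_eq cstar_subalgebra_corner)

lemma commutative_set_mono: "S \<subseteq> T \<Longrightarrow> commutative_set T \<Longrightarrow> commutative_set S"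
  unfolding commutative_set_def by blast

lemma abelian_element_if_mem:
  assumes B: "cstar_subalgebra B" "commutative_set B" and y: "pos y"
    and yB: "\<And>a. y * a * y \<in> B"
  shows "abelian_element UNIV y"
proof -
  have "closure {y * a * y |a. a \<in> UNIV} \<subseteq> B"
    using B(1) yB by (intro closure_minimal) (auto simp: cstar_subalgebra_def)
  then show ?thesis
    using y commutative_set_mono[OF _ B(2)] by (simp add: abelian_element_def pos_cone_UNIV)
qed

lemma abelian_hereditary_if_abelian_element:
  assumes y: "abelian_element UNIV y" "y \<noteq> 0"
  obtains B where "abelian_hereditary B" "B \<noteq> {0}" "\<forall>b\<in>B. \<exists>a. b = y * a * y"
proof -
  have py: "pos y" and com: "commutative_set (closure {y * a * y |a. a \<in> UNIV})"
    using y(1) by (auto simp: abelian_element_def pos_cone_UNIV)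
  obtain e where e: "star e = e" "corner e \<noteq> {0}" "\<forall>b\<in>corner e. \<exists>a. b = y * a * y"
    "\<forall>b\<in>corner e. pos b \<longrightarrow> (\<exists>C>0. pos (C *\<^sub>R y - b))"
    using corner_below[OF py y(2)] .
  have "corner e \<subseteq> {y * a * y |a. a \<in> UNIV}" using e(3) by simp blast
  then have "corner e \<subseteq> closure {y * a * y |a. a \<in> UNIV}"
    using closure_subset by (rule order_trans)
  then have "abelian_hereditary (corner e)"
    using commutative_set_mono[OF _ com] hereditary_corner[OF e(1)] by (simp add: abelian_hereditary_def)
  then show thesis by (rule that[OF _ e(2,3)])
qed

text \<open>With \<open>t = 1 / C\<close>, the remainder \<open>u = x - t b\<close> is positive.
  Adding \<open>u\<close> to \<open>t y\<close> and \<open>t b\<close> turns an equivalence of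
  \<open>y\<close> with \<open>b\<close> into one of \<open>t y + u\<close> with \<open>x\<close>,
  and finiteness of \<open>x\<close> forces equality.\<close>

lemma finite_element_dominated:
  fixes x b :: "'a::cstar_algebra"
  assumes x: "finite_element UNIV x" and b: "pos b" and C: "0 < C" "pos (C *\<^sub>R x - b)"
  shows "finite_element UNIV b"
  unfolding finite_element_def
proof (intro conjI allI impI; (elim conjE)?)
  show "b \<in> pos_cone UNIV" using b by (simp add: pos_cone_UNIV)
  fix y assume d: "dominates UNIV b y" and eq: "cp_equiv UNIV y b"
  define t where "t = 1 / C"
  have t: "t > 0" "t * C = 1" using C by (simp_all add: t_def)
  define u where "u = x - t *\<^sub>R b"
  have "u = t *\<^sub>R (C *\<^sub>R x - b)" using t(2) by (simp add: u_def scaleR_diff_right)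
  then have u: "pos u" using C t by (simp add: pos_scaleR)
  obtain r where r: "star r = r" "r * r = u"
    using pos_sqrt_in[OF cstar_subalgebra_UNIV u] by auto
  obtain z :: "nat \<Rightarrow> 'a" where z: "(\<lambda>k. star (z k) * z k) sums y" "(\<lambda>k. z k * star (z k)) sums b"
    using eq by (auto simp: cp_equiv_def)
  have py: "pos y" "pos (b - y)" using d by (simp_all add: dominates_UNIV)
  have px: "pos x" using x by (simp add: finite_element_def pos_cone_UNIV)
  \<comment> \<open>The entry at index 0 is the root of \<open>u\<close>, which contributes
    \<open>u\<close> to both series; the rescaled \<open>z\<close> is shifted by one.\<close>
  define w where "w k = (case k of 0 \<Rightarrow> r | Suc j \<Rightarrow> sqrt t *\<^sub>R z j)" for k
  have "(\<lambda>k. star (w (Suc k)) * w (Suc k)) sums (t *\<^sub>R y)"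
    using sums_scaleR_right[OF z(1), of t] t by (simp add: w_def star_scaleR)
  then have 1: "(\<lambda>k. star (w k) * w k) sums (t *\<^sub>R y + u)"
    using sums_Suc[of "\<lambda>k. star (w k) * w k"] r by (simp add: w_def)
  have "(\<lambda>k. w (Suc k) * star (w (Suc k))) sums (t *\<^sub>R b)"
    using sums_scaleR_right[OF z(2), of t] t by (simp add: w_def star_scaleR)
  then have 2: "(\<lambda>k. w k * star (w k)) sums (t *\<^sub>R b + u)"
    using sums_Suc[of "\<lambda>k. w k * star (w k)"] r by (simp add: w_def)
  have x': "t *\<^sub>R b + u = x" by (simp add: u_def)
  have p: "pos (t *\<^sub>R y + u)" using t py u by (intro pos_add pos_scaleR) auto
  have "x - (t *\<^sub>R y + u) = t *\<^sub>R (b - y)" by (simp add: u_def algebra_simps)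
  then have "dominates UNIV x (t *\<^sub>R y + u)"
    using p px py t by (simp add: dominates_UNIV pos_scaleR)
  moreover have "cp_equiv UNIV (t *\<^sub>R y + u) x"
    using 1 2 p px unfolding x' by (auto simp: cp_equiv_def pos_cone_UNIV)
  ultimately have "t *\<^sub>R y + u = x" using x by (simp add: finite_element_def)
  then have "t *\<^sub>R y = t *\<^sub>R b" unfolding u_def by (simp add: algebra_simps)
  then show "y = b" using t by simp
qed

lemma finite_element_mono:
  assumes "B \<subseteq> B'" "finite_element B' b" "b \<in> pos_cone B"
  shows "finite_element B b"
  unfolding finite_element_def
proof (intro conjI allI impI; (elim conjE)?)
  fix y assume "dominates B b y" "cp_equiv B y b"
  then have "dominates B' b y" "cp_equiv B' y b"
    using pos_cone_mono[OF assms(1)] assms(1) unfolding dominates_def cp_equiv_def by blast+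
  then show "y = b" using assms(2) by (auto simp: finite_element_def)
qed (rule assms(3))

lemma finite_hereditary_if_finite_element:
  assumes y: "finite_element UNIV y" "y \<noteq> 0"
  obtains B where "finite_hereditary B" "B \<noteq> {0}" "\<forall>b\<in>B. \<exists>a. b = y * a * y"
proof -
  have py: "pos y" using y(1) by (simp add: finite_element_def pos_cone_UNIV)
  obtain e where e: "star e = e" "corner e \<noteq> {0}" "\<forall>b\<in>corner e. \<exists>a. b = y * a * y"
    "\<forall>b\<in>corner e. pos b \<longrightarrow> (\<exists>C>0. pos (C *\<^sub>R y - b))"
    using corner_below[OF py y(2)] .
  have "finite_element (corner e) b" if "b \<in> pos_cone (corner e)" for b
  proof -
    have b: "b \<in> corner e" "pos b" using that by (simp_all add: pos_cone_corner[OF e(1)])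
    obtain C where "C > 0" "pos (C *\<^sub>R y - b)" using e(4) b by blast
    then have "finite_element UNIV b" by (rule finite_element_dominated[OF y(1) b(2)])
    then show ?thesis by (rule finite_element_mono[OF subset_UNIV _ that])
  qed
  then have "finite_hereditary (corner e)"
    using hereditary_corner[OF e(1)] by (simp add: finite_hereditary_def finite_algebra_def)
  then show thesis by (rule that[OF _ e(2,3)])
qed

lemma corner_if_star_mult_self:
  assumes se: "star e = e" and z: "star z * z \<in> corner e"
  shows "z * e = z"
proof -
  have "star (z * e - z) * (z * e - z)
      = e * (star z * z) * e - e * (star z * z) - (star z * z) * e + star z * z"
    by (simp add: star_diff star_mult se algebra_simps)
  also have "\<dots> = 0" using z by (simp add: corner_def)
  finally show ?thesis by (simp add: star_mult_self_eq_0)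
qed

lemma pos_sums_minus:
  fixes f :: "nat \<Rightarrow> 'a::cstar_algebra"
  assumes "f sums l" "\<And>k. pos (f k)"
  shows "pos (l - f k)"
proof -
  \<comment> \<open>Starting with \<open>Suc k\<close> terms ensures that \<open>f k\<close> is
    always among the summands.\<close>
  have "pos ((\<Sum>i<n + Suc k. f i) - f k)" for n
  proof -
    have "(\<Sum>i<n + Suc k. f i) = f k + (\<Sum>i\<in>{..<n + Suc k} - {k}. f i)"
      by (rule sum.remove) auto
    moreover have "pos (\<Sum>i\<in>A. f i)" if "finite A" for A
      using that by induction (auto intro: pos_add assms)
    ultimately show ?thesis by simp
  qed
  moreover have "(\<lambda>n. (\<Sum>i<n + Suc k. f i) - f k) \<longlonglongrightarrow> l - f k"
    using assms(1) unfolding sums_def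
    by (intro tendsto_intros) (rule LIMSEQ_ignore_initial_segment)
  ultimately show ?thesis
    using closed_sequentially[OF closed_pos, of "\<lambda>n. (\<Sum>i<n + Suc k. f i) - f k"] by simp
qed

text \<open>Finiteness in the corner is a priori weaker, as it admits fewer witnesses. But each
  \<open>star (z k) * z k\<close> lies below \<open>y\<close> and each
  \<open>z k * star (z k)\<close> below \<open>d\<close>, so \<open>corner_dominated\<close> forces
  every \<open>z k\<close> into the corner.\<close>

lemma finite_element_if_corner_finite:
  fixes e :: "'a::cstar_algebra"
  assumes se: "star e = e" and fin: "finite_algebra (corner e)"
    and d: "d \<in> corner e" "pos d" "d \<noteq> 0"
  shows "finite_element UNIV d"
  unfolding finite_element_def
proof (intro conjI allI impI; (elim conjE)?)
  show "d \<in> pos_cone UNIV" using d by (simp add: pos_cone_UNIV)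
  fix y assume dom: "dominates UNIV d y" and eq: "cp_equiv UNIV y d"
  have py: "pos y" "pos (d - y)" using dom by (simp_all add: dominates_UNIV)
  have cs: "complex_subspace (corner e)"
    using cstar_subalgebra_corner[OF se] by (simp add: cstar_subalgebra_def)
  have de: "d * e = d" using d(1) by (simp add: corner_def)
  have y: "y \<in> corner e" by (rule corner_dominated[OF se de py])
  then have ye: "y * e = y" by (simp add: corner_def)
  obtain z :: "nat \<Rightarrow> 'a" where z: "(\<lambda>k. star (z k) * z k) sums y" "(\<lambda>k. z k * star (z k)) sums d"
    using eq by (auto simp: cp_equiv_def)
  have "z k \<in> corner e" for k
  proof -
    have "star (z k) * z k \<in> corner e"
      by (rule corner_dominated[OF se ye pos_star_mult_self pos_sums_minus[OF z(1) pos_star_mult_self]])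
    then have 1: "z k * e = z k" by (rule corner_if_star_mult_self[OF se])
    have "z k * star (z k) \<in> corner e"
      by (rule corner_dominated[OF se de pos_mult_star_self pos_sums_minus[OF z(2) pos_mult_star_self]])
    then have "star (z k) * e = star (z k)"
      using corner_if_star_mult_self[OF se, of "star (z k)"] by (simp add: star_star)
    then have "star (star (z k) * e) = star (star (z k))" by (rule arg_cong)
    then have "e * z k = z k" by (simp add: star_mult star_star se)
    with 1 show ?thesis by (simp add: corner_def)
  qed
  then have "cp_equiv (corner e) y d"
    using z y d py by (auto simp: cp_equiv_def pos_cone_corner[OF se])
  moreover have "dominates (corner e) d y"
    using y d py subalgebra_diff[OF cs d(1) y] by (simp add: dominates_def pos_cone_corner[OF se])
  moreover have "finite_element (corner e) d"
    using fin d by (simp add: finite_algebra_def pos_cone_corner[OF se])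
  ultimately show "y = d" by (simp add: finite_element_def)
qed

lemma finite_algebra_mono:
  assumes "B \<subseteq> B'" "finite_algebra B'"
  shows "finite_algebra B"
  unfolding finite_algebra_def
proof (intro ballI impI)
  fix x assume x: "x \<in> pos_cone B" "x \<noteq> 0"
  then have "finite_element B' x"
    using assms(2) pos_cone_mono[OF assms(1)] by (auto simp: finite_algebra_def)
  then show "finite_element B x" by (rule finite_element_mono[OF assms(1) _ x(1)])
qed

section \<open>Transport of commutativity and finiteness between linked corners\<close>

text \<open>On the corner of \<open>v v*\<close> the map \<open>c \<mapsto> v* c v\<close> is an injective *-homomorphism,
  with inverse \<open>b \<mapsto> v b v*\<close>.\<close>

lemma corner_conj_inverse:
  assumes "c \<in> corner (v * star v)"
  shows "v * (star v * c * v) * star v = c"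
proof -
  have "v * (star v * c * v) * star v = (v * star v) * c * (v * star v)" by (simp add: mult.assoc)
  then show ?thesis using assms by (simp add: corner_def)
qed

lemma corner_conj_mult:
  assumes "c' \<in> corner (v * star v)"
  shows "(star v * c * v) * (star v * c' * v) = star v * (c * c') * v"
proof -
  have "(star v * c * v) * (star v * c' * v) = star v * c * ((v * star v) * c') * v"
    by (simp add: mult.assoc)
  also have "(v * star v) * c' = c'" using assms by (simp add: corner_def)
  finally show ?thesis by (simp add: mult.assoc)
qed

lemma commutative_corner_conj:
  assumes C: "\<forall>c. star v * c * v \<in> C" "commutative_set C"
  shows "commutative_set (corner (v * star v))"
  unfolding commutative_set_def
proof (intro ballI)
  fix c d assume c: "c \<in> corner (v * star v)" and d: "d \<in> corner (v * star v)"
  have f: "star (v * star v) = v * star v" by (simp add: star_mult star_star)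
  have "c * d \<in> corner (v * star v)" "d * c \<in> corner (v * star v)"
    using c d cstar_subalgebra_corner[OF f] by (simp_all add: cstar_subalgebra_def)
  moreover have "(star v * c * v) * (star v * d * v) = (star v * d * v) * (star v * c * v)"
    by (rule C(2)[unfolded commutative_set_def, rule_format]; rule C(1)[rule_format])
  then have "star v * (c * d) * v = star v * (d * c) * v"
    by (simp only: corner_conj_mult[OF c] corner_conj_mult[OF d])
  then have "v * (star v * (c * d) * v) * star v = v * (star v * (d * c) * v) * star v"
    by (rule arg_cong)
  ultimately show "c * d = d * c" by (simp only: corner_conj_inverse)
qed

text \<open>The map sends squares to squares and, being continuous, series to series. So domination
  and equivalence in the corner carry over to the images in \<open>C\<close>; finiteness identifies
  the images and injectivity the originals.\<close>

lemma finite_corner_conj: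
  fixes v :: "'a::cstar_algebra"
  assumes C: "\<forall>c. star v * c * v \<in> C" and fin: "finite_algebra C"
  shows "finite_algebra (corner (v * star v))"
proof -
  let ?D = "corner (v * star v)" and ?p = "\<lambda>c. star v * c * v"
  have f: "star (v * star v) = v * star v" by (simp add: star_mult star_star)
  have starD: "star c \<in> ?D" if "c \<in> ?D" for c
    using that cstar_subalgebra_corner[OF f] by (simp add: cstar_subalgebra_def)
  have star: "?p (star c) = star (?p c)" for c by (simp add: star_mult star_star mult.assoc)
  have sq1: "?p (star c * c) = star (?p c) * ?p c"
    and sq2: "?p (c * star c) = ?p c * star (?p c)" if "c \<in> ?D" for c
    using corner_conj_mult[OF that, of "star c"] corner_conj_mult[OF starD[OF that], of c]
    by (simp_all only: star)
  have cone: "?p c \<in> pos_cone C" if c: "c \<in> pos_cone ?D" for c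
  proof -
    obtain w where w: "c = star w * w" "w \<in> ?D" using c unfolding pos_cone_def by blast
    have "?p w \<in> C" using C by blast
    then show ?thesis unfolding w(1) sq1[OF w(2)] by (auto simp: pos_cone_def)
  qed
  have bl: "bounded_linear ?p"
    using bounded_linear_compose[OF bounded_linear_mult_left bounded_linear_mult_right] .
  show ?thesis unfolding finite_algebra_def
  proof (intro ballI impI)
    fix y assume y: "y \<in> pos_cone ?D" "y \<noteq> 0"
    then have yD: "y \<in> ?D" by (simp add: pos_cone_corner[OF f])
    have "?p y \<noteq> 0"
    proof
      assume "?p y = 0"
      with corner_conj_inverse[OF yD] show False using y(2) by simp
    qed
    then have fy: "finite_element C (?p y)"
      using fin cone[OF y(1)] by (simp add: finite_algebra_def)
    have "y' = y" if dom: "dominates ?D y y'" and eq: "cp_equiv ?D y' y" for y'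
    proof -
      have y': "y' \<in> pos_cone ?D" using dom by (simp add: dominates_def)
      obtain z where z: "\<And>k. z k \<in> ?D" "(\<lambda>k. star (z k) * z k) sums y'" "(\<lambda>k. z k * star (z k)) sums y"
        using eq by (auto simp: cp_equiv_def)
      have "(\<lambda>k. star (?p (z k)) * ?p (z k)) sums ?p y'" "(\<lambda>k. ?p (z k) * star (?p (z k))) sums ?p y"
        using bounded_linear.sums[OF bl z(2)] bounded_linear.sums[OF bl z(3)]
        by (simp_all only: sq1[OF z(1)] sq2[OF z(1)])
      then have "cp_equiv C (?p y') (?p y)"
        unfolding cp_equiv_def using C cone[OF y'] cone[OF y(1)]
        by (intro conjI exI[of _ "\<lambda>k. ?p (z k)"]) simp_all
      moreover have "?p (y - y') = ?p y - ?p y'" by (simp add: algebra_simps)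
      then have "dominates C (?p y) (?p y')"
        using dom cone[of y] cone[of y'] cone[of "y - y'"] by (simp add: dominates_def)
      ultimately have "?p y' = ?p y" using fy by (simp add: finite_element_def)
      then have "v * ?p y' * star v = v * ?p y * star v" by (rule arg_cong)
      then show "y' = y"
        using corner_conj_inverse[OF yD] corner_conj_inverse[of y'] y' by (simp add: pos_cone_corner[OF f])
    qed
    then show "finite_element ?D y" using y(1) by (auto simp: finite_element_def)
  qed
qed

section \<open>Ideals\<close>

lemma ideal_annihilator:
  assumes J: "ideal_of_algebra J"
  shows "ideal_of_algebra (annihilator J)"
  unfolding ideal_of_algebra_def
proof (intro conjI allI ballI)
  show "complex_subspace (annihilator J)"
    by (auto simp: complex_subspace_def annihilator_def distrib_left distrib_right
        mult_scaleC_left mult_scaleC_right)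
  fix a x assume x: "x \<in> annihilator J"
  have J': "j * a \<in> J" "a * j \<in> J" if "j \<in> J" for j
    using that J by (auto simp: ideal_of_algebra_def)
  have "a * x * j = 0 \<and> j * (a * x) = 0 \<and> x * a * j = 0 \<and> j * (x * a) = 0" if "j \<in> J" for j
  proof -
    have "a * x * j = a * (x * j)" "j * (a * x) = j * a * x" "x * a * j = x * (a * j)" "j * (x * a) = j * x * a"
      by (simp_all add: mult.assoc)
    then show ?thesis using x J'[OF that] that by (simp add: annihilator_def)
  qed
  then show "a * x \<in> annihilator J" "x * a \<in> annihilator J" by (simp_all add: annihilator_def)
qed

lemma closed_annihilator: "closed (annihilator J)"
proof -
  have "annihilator J = (\<Inter>x\<in>J. {a. a * x = 0 \<and> x * a = 0})" by (auto simp: annihilator_def)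
  also have "closed \<dots>"
    by (intro closed_INT ballI closed_Collect_conj closed_Collect_eq continuous_intros)
  finally show ?thesis .
qed

lemma normal_ideal_closed: "normal_ideal I \<Longrightarrow> closed_ideal I"
  using closed_annihilator by (auto simp: normal_ideal_def closed_ideal_def)

text \<open>An ideal that is not closed may fail to be hereditary. The corner below
  \<open>x = star j * j\<close> is hereditary and lies in \<open>x A x\<close>, hence in
  \<open>J\<close>, so everything below its member \<open>d\<close> stays in
  \<open>J\<close>.\<close>

lemma ideal_pos_below:
  assumes J: "ideal_of_algebra J" "J \<noteq> {0}"
  obtains d where "pos d" "d \<noteq> 0" "\<forall>y. dominates UNIV d y \<longrightarrow> y \<in> J"
proof -
  obtain j where j: "j \<in> J" "j \<noteq> 0"
    using J by (auto simp: ideal_of_algebra_def complex_subspace_def)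
  define x where "x = star j * j"
  have x: "pos x" "x \<noteq> 0" "x \<in> J"
    using j J(1) by (auto simp: x_def pos_star_mult_self star_mult_self_eq_0 ideal_of_algebra_def)
  obtain e where e: "star e = e" "corner e \<noteq> {0}" "\<forall>b\<in>corner e. \<exists>a. b = x * a * x"
    "\<forall>b\<in>corner e. pos b \<longrightarrow> (\<exists>C>0. pos (C *\<^sub>R x - b))"
    using corner_below[OF x(1,2)] .
  obtain d where d: "d \<in> corner e" "pos d" "d \<noteq> 0" using corner_pos_exists[OF e(1,2)] .
  show thesis
  proof (rule that[OF d(2,3)], intro allI impI)
    fix y assume "dominates UNIV d y"
    then have "y \<in> corner e"
      using corner_dominated[OF e(1), of d y] d(1) by (simp add: dominates_UNIV corner_def)
    then obtain a where "y = x * a * x" using e(3) by blast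
    then show "y \<in> J" using J(1) x(3) by (simp add: ideal_of_algebra_def)
  qed
qed

text \<open>The annihilator of the ideal generated by \<open>x\<close>.\<close>

definition two_sided_annihilator :: "'a::cstar_algebra \<Rightarrow> 'a set" where
  "two_sided_annihilator x = {a. \<forall>c. x * c * a = 0 \<and> a * c * x = 0}"

lemma ideal_two_sided_annihilator: "ideal_of_algebra (two_sided_annihilator x)"
  unfolding ideal_of_algebra_def
proof (intro conjI allI ballI)
  show "complex_subspace (two_sided_annihilator x)"
    by (auto simp: complex_subspace_def two_sided_annihilator_def distrib_left distrib_right
        mult_scaleC_left mult_scaleC_right)
  fix a b assume b: "b \<in> two_sided_annihilator x"
  have "x * c * (a * b) = 0 \<and> a * b * c * x = 0 \<and> x * c * (b * a) = 0 \<and> b * a * c * x = 0" for c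
  proof -
    have "x * c * (a * b) = x * (c * a) * b" "a * b * c * x = a * (b * c * x)"
      "x * c * (b * a) = x * c * b * a" "b * a * c * x = b * (a * c) * x"
      by (simp_all add: mult.assoc)
    then show ?thesis using b by (simp add: two_sided_annihilator_def)
  qed
  then show "a * b \<in> two_sided_annihilator x" "b * a \<in> two_sided_annihilator x"
    by (simp_all add: two_sided_annihilator_def)
qed

text \<open>Without a unit, \<open>x * j = 0\<close> is not an instance of the definition. Taking
  \<open>c = x\<close> gives \<open>x * x * j = 0\<close>, and the C*-identity removes one
  factor.\<close>

lemma pos_mem_double_annihilator:
  assumes "pos x"
  shows "x \<in> annihilator (two_sided_annihilator x)"
proof -
  have "x * j = 0 \<and> j * x = 0" if j: "j \<in> two_sided_annihilator x" for j
  proof -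
    have sx: "star x = x" using assms by (rule pos_sa)
    have "star (x * j) * (x * j) = star j * (x * x * j)" by (simp add: star_mult sx mult.assoc)
    then have "x * j = 0" using j star_mult_self_eq_0[of "x * j"] by (simp add: two_sided_annihilator_def)
    moreover have "(j * x) * star (j * x) = (j * x * x) * star j" by (simp add: star_mult sx mult.assoc)
    then have "j * x = 0" using j mult_star_self_eq_0[of "j * x"] by (simp add: two_sided_annihilator_def)
    ultimately show ?thesis by simp
  qed
  then show ?thesis by (simp add: annihilator_def)
qed

text \<open>If \<open>B\<close> is hereditary and lies in the normal ideal generated by \<open>x\<close>, then
  \<open>x a b \<noteq> 0\<close> for some \<open>b \<in> B\<close>, and the polar decomposition of \<open>x a b\<close> links a corner inside
  \<open>B\<close> with a corner below \<open>x\<close>.\<close>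

lemma linked_corner_exists:
  fixes x :: "'a::cstar_algebra"
  assumes x: "pos x" and B: "hereditary_subalgebra B" "B \<noteq> {0}"
    and BI: "B \<subseteq> annihilator (two_sided_annihilator x)"
  obtains v where "corner (v * star v) \<noteq> {0}" "\<forall>b. star v * b * v \<in> B"
    "\<forall>y\<in>corner (v * star v). pos y \<longrightarrow> (\<exists>C>0. pos (C *\<^sub>R x - y))"
proof -
  \<comment> \<open>Passing to a corner makes products \<open>b * a * b'\<close> with arbitrary
    \<open>a\<close> stay inside \<open>B\<close> by the defining equations alone.\<close>
  obtain e where e: "star e = e" "corner e \<noteq> {0}" "corner e \<subseteq> B"
    using hereditary_contains_corner[OF B] by blast
  have sx: "star x = x" using x by (rule pos_sa)
  have starC: "star b \<in> corner e" if "b \<in> corner e" for b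
    using that cstar_subalgebra_corner[OF e(1)] by (simp add: cstar_subalgebra_def)
  \<comment> \<open>Otherwise a non-zero \<open>b\<close> would lie in the annihilator of the ideal
    generated by \<open>x\<close>, while \<open>star b\<close> annihilates that annihilator; then
    \<open>star b * b = 0\<close>.\<close>
  have "\<exists>a. \<exists>b\<in>corner e. x * a * b \<noteq> 0"
  proof (rule ccontr)
    assume "\<not> ?thesis"
    then have z: "x * c * b = 0" if "b \<in> corner e" for b c using that by blast
    obtain b where b: "b \<in> corner e" "b \<noteq> 0" using nonzero_member[OF corner_0 e(2)] .
    have "b * c * x = 0" for c
    proof -
      have "star (x * star c * star b) = 0" using z[OF starC[OF b(1)]] by simp
      then show ?thesis by (simp add: star_mult star_star sx mult.assoc)
    qed
    then have "b \<in> two_sided_annihilator x" using z[OF b(1)] by (simp add: two_sided_annihilator_def)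
    moreover have "star b \<in> annihilator (two_sided_annihilator x)" using starC[OF b(1)] e(3) BI by blast
    ultimately have "star b * b = 0" by (simp add: annihilator_def)
    then show False using b(2) by (simp add: star_mult_self_eq_0)
  qed
  then obtain a b where b: "b \<in> corner e" "x * a * b \<noteq> 0" by blast
  obtain r where r: "star r = r" "r * r = x"
    using pos_sqrt_in[OF cstar_subalgebra_UNIV x] by auto
  define z where "z = x * a * b"
  obtain v c where v: "corner (v * star v) \<noteq> {0}" "\<forall>b. \<exists>b'. star v * b * v = star z * b' * z"
    "0 \<le> c" "pos (c *\<^sub>R (z * star z) - v * star v)"
    using corner_exists[of z] b(2) unfolding z_def by blast
  \<comment> \<open>Splitting \<open>x = r * r\<close> leaves one \<open>r\<close> on each side of
    \<open>h\<close>, so \<open>z * star z = r * h * r\<close> is at most \<open>norm h\<close>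
    times \<open>x\<close>.\<close>
  define h where "h = (r * a * b) * star (r * a * b)"
  have sh: "star h = h" by (simp add: h_def star_mult star_star mult.assoc)
  have zz: "z * star z = star r * h * r"
    by (simp add: z_def h_def star_mult star_star r(1) mult.assoc flip: r(2))
  have hx: "pos (norm h *\<^sub>R x - z * star z)"
    using pos_norm_conj(1)[OF sh, of r] unfolding zz by (simp add: r)
  show thesis
  proof (rule that[OF v(1)]; intro allI ballI impI)
    fix c
    obtain c' where c': "star v * c * v = star z * c' * z" using v(2) by blast
    have "star z * c' * z = star b * (star (x * a) * c' * (x * a)) * b"
      by (simp add: z_def star_mult mult.assoc)
    then show "star v * c * v \<in> B"
      unfolding c' using corner_mult_mult[OF starC[OF b(1)] b(1)] e(3) by auto
  next
    fix y assume y: "y \<in> corner (v * star v)" "pos y"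
    obtain C where C: "C > 0" "pos (C *\<^sub>R (z * star z) - y)"
      using corner_pos_dominated[OF y v(3,4)] by blast
    have "(C * norm h + 1) *\<^sub>R x - y = C *\<^sub>R (norm h *\<^sub>R x - z * star z) + (C *\<^sub>R (z * star z) - y) + x"
      by (simp add: algebra_simps)
    moreover have "pos (C *\<^sub>R (norm h *\<^sub>R x - z * star z) + (C *\<^sub>R (z * star z) - y) + x)"
      using C hx x by (intro pos_add pos_scaleR) auto
    ultimately have "pos ((C * norm h + 1) *\<^sub>R x - y)" by (simp only:)
    moreover have "C * norm h + 1 > 0" using C by (simp add: add_nonneg_pos)
    ultimately show "\<exists>C>0. pos (C *\<^sub>R x - y)" by blast
  qed
qed

lemma dominated_in_corner:
  assumes f: "star f = f" "corner f \<noteq> {0}"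
    and dom: "\<forall>y\<in>corner f. pos y \<longrightarrow> (\<exists>C>0. pos (C *\<^sub>R x - y))" and x: "pos x"
  obtains y where "y \<in> corner f" "pos y" "y \<noteq> 0" "dominates UNIV x y"
proof -
  obtain d where d: "d \<in> corner f" "pos d" "d \<noteq> 0" using corner_pos_exists[OF f] .
  obtain C where C: "C > 0" "pos (C *\<^sub>R x - d)" using dom d(1,2) by blast
  have cs: "complex_subspace (corner f)"
    using cstar_subalgebra_corner[OF f(1)] by (simp add: cstar_subalgebra_def)
  have "x - (1 / C) *\<^sub>R d = (1 / C) *\<^sub>R (C *\<^sub>R x - d)" using C by (simp add: scaleR_diff_right)
  then have "dominates UNIV x ((1 / C) *\<^sub>R d)"
    using C d x by (simp add: dominates_UNIV pos_scaleR)
  then show thesis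
    using C d by (intro that[of "(1 / C) *\<^sub>R d"] subalgebra_scaleR[OF cs] pos_scaleR) auto
qed

lemma normal_ideal_double_annihilator: "normal_ideal (annihilator (two_sided_annihilator x))"
  using ideal_two_sided_annihilator ideal_annihilator unfolding normal_ideal_def by blast

section \<open>The classification\<close>

lemma abelian_element_iff_hereditary:
  "(\<exists>x::'a::cstar_algebra. x \<noteq> 0 \<and> abelian_element UNIV x) \<longleftrightarrow>
   (\<exists>B::'a set. B \<noteq> {0} \<and> abelian_hereditary B)"
proof
  assume "\<exists>x::'a. x \<noteq> 0 \<and> abelian_element UNIV x"
  then obtain x :: 'a where x: "abelian_element UNIV x" "x \<noteq> 0" by blast
  show "\<exists>B::'a set. B \<noteq> {0} \<and> abelian_hereditary B"
    by (rule abelian_hereditary_if_abelian_element[OF x]) blast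
next
  assume "\<exists>B::'a set. B \<noteq> {0} \<and> abelian_hereditary B"
  then obtain B :: "'a set" where B: "B \<noteq> {0}" "hereditary_subalgebra B" "commutative_set B"
    by (auto simp: abelian_hereditary_def)
  obtain e where e: "star e = e" "corner e \<noteq> {0}" "corner e \<subseteq> B"
    using hereditary_contains_corner[OF B(2,1)] by blast
  obtain d where d: "d \<in> corner e" "pos d" "d \<noteq> 0" using corner_pos_exists[OF e(1,2)] .
  have "abelian_element UNIV d"
    by (rule abelian_element_if_mem[OF cstar_subalgebra_corner[OF e(1)]
          commutative_set_mono[OF e(3) B(3)] d(2) corner_mult_mult[OF d(1) d(1)]])
  then show "\<exists>x::'a. x \<noteq> 0 \<and> abelian_element UNIV x" using d(3) by blast
qed

lemma finite_element_iff_hereditary: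
  "(\<exists>x::'a::cstar_algebra. x \<noteq> 0 \<and> finite_element UNIV x) \<longleftrightarrow>
   (\<exists>B::'a set. B \<noteq> {0} \<and> finite_hereditary B)"
proof
  assume "\<exists>x::'a. x \<noteq> 0 \<and> finite_element UNIV x"
  then obtain x :: 'a where x: "finite_element UNIV x" "x \<noteq> 0" by blast
  show "\<exists>B::'a set. B \<noteq> {0} \<and> finite_hereditary B"
    by (rule finite_hereditary_if_finite_element[OF x]) blast
next
  assume "\<exists>B::'a set. B \<noteq> {0} \<and> finite_hereditary B"
  then obtain B :: "'a set" where B: "B \<noteq> {0}" "hereditary_subalgebra B" "finite_algebra B"
    by (auto simp: finite_hereditary_def)
  obtain e where e: "star e = e" "corner e \<noteq> {0}" "corner e \<subseteq> B"
    using hereditary_contains_corner[OF B(2,1)] by blast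
  obtain d where d: "d \<in> corner e" "pos d" "d \<noteq> 0" using corner_pos_exists[OF e(1,2)] .
  have "finite_element UNIV d"
    by (rule finite_element_if_corner_finite[OF e(1) finite_algebra_mono[OF e(3) B(3)] d])
  then show "\<exists>x::'a. x \<noteq> 0 \<and> finite_element UNIV x" using d(3) by blast
qed

lemma discrete_imp_ideals:
  fixes J :: "'a::cstar_algebra set"
  assumes "discrete_algebra (UNIV :: 'a set)" and J: "closed_ideal J" "J \<noteq> {0}"
  shows "\<exists>B \<subseteq> J. B \<noteq> {0} \<and> abelian_hereditary B"
proof -
  have id: "ideal_of_algebra J" using J by (simp add: closed_ideal_def)
  obtain d where d: "pos d" "d \<noteq> 0" "\<forall>y. dominates UNIV d y \<longrightarrow> y \<in> J"
    using ideal_pos_below[OF id J(2)] .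
  obtain y where y: "y \<noteq> 0" "dominates UNIV d y" "abelian_element UNIV y"
    using assms(1) d by (auto simp: discrete_algebra_def pos_cone_UNIV)
  obtain B where B: "abelian_hereditary B" "B \<noteq> {0}" "\<forall>b\<in>B. \<exists>a. b = y * a * y"
    using abelian_hereditary_if_abelian_element[OF y(3,1)] .
  \<comment> \<open>Since \<open>y\<close> is below \<open>d\<close> it belongs to \<open>J\<close>,
    and with it all of \<open>y A y\<close>, where \<open>B\<close> lives.\<close>
  have "y * a * y \<in> J" for a using d(3) y(2) id by (simp add: ideal_of_algebra_def)
  then have "B \<subseteq> J" using bspec[OF B(3)] by (metis subsetI)
  then show ?thesis using B by blast
qed

lemma semifinite_imp_ideals:
  fixes J :: "'a::cstar_algebra set"
  assumes "semifinite_algebra (UNIV :: 'a set)" and J: "closed_ideal J" "J \<noteq> {0}"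
  shows "\<exists>B \<subseteq> J. B \<noteq> {0} \<and> finite_hereditary B"
proof -
  have id: "ideal_of_algebra J" using J by (simp add: closed_ideal_def)
  obtain d where d: "pos d" "d \<noteq> 0" "\<forall>y. dominates UNIV d y \<longrightarrow> y \<in> J"
    using ideal_pos_below[OF id J(2)] .
  obtain y where y: "y \<noteq> 0" "dominates UNIV d y" "finite_element UNIV y"
    using assms(1) d by (auto simp: semifinite_algebra_def pos_cone_UNIV)
  obtain B where B: "finite_hereditary B" "B \<noteq> {0}" "\<forall>b\<in>B. \<exists>a. b = y * a * y"
    using finite_hereditary_if_finite_element[OF y(3,1)] .
  have "y * a * y \<in> J" for a using d(3) y(2) id by (simp add: ideal_of_algebra_def)
  then have "B \<subseteq> J" using bspec[OF B(3)] by (metis subsetI)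
  then show ?thesis using B by blast
qed

text \<open>The hypothesis is used for the double annihilator, which is non-zero because it contains
  \<open>x\<close>. The \<open>B\<close> found there may have no member below \<open>x\<close>, so
  its commutativity is moved to a linked corner that has one.\<close>

lemma normal_ideals_imp_discrete:
  assumes *: "\<And>J :: 'a::cstar_algebra set. normal_ideal J \<Longrightarrow> J \<noteq> {0} \<Longrightarrow>
    \<exists>B \<subseteq> J. B \<noteq> {0} \<and> abelian_hereditary B"
  shows "discrete_algebra (UNIV :: 'a set)"
  unfolding discrete_algebra_def pos_cone_UNIV
proof (intro ballI impI)
  fix x :: 'a assume "x \<in> {a. pos a}" and x0: "x \<noteq> 0"
  then have x: "pos x" by simp
  have "annihilator (two_sided_annihilator x) \<noteq> {0}"
    using pos_mem_double_annihilator[OF x] x0 by blast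
  then obtain B where B: "B \<subseteq> annihilator (two_sided_annihilator x)" "B \<noteq> {0}"
    "hereditary_subalgebra B" "commutative_set B"
    using *[OF normal_ideal_double_annihilator] by (auto simp: abelian_hereditary_def)
  obtain v where v: "corner (v * star v) \<noteq> {0}" "\<forall>b. star v * b * v \<in> B"
    "\<forall>y\<in>corner (v * star v). pos y \<longrightarrow> (\<exists>C>0. pos (C *\<^sub>R x - y))"
    using linked_corner_exists[OF x B(3,2,1)] .
  have f: "star (v * star v) = v * star v" by (simp add: star_mult star_star)
  obtain y where y: "y \<in> corner (v * star v)" "pos y" "y \<noteq> 0" "dominates UNIV x y"
    using dominated_in_corner[OF f v(1,3) x] .
  have "abelian_element UNIV y"
    by (rule abelian_element_if_mem[OF cstar_subalgebra_corner[OF f]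
          commutative_corner_conj[OF v(2) B(4)] y(2) corner_mult_mult[OF y(1) y(1)]])
  then show "\<exists>y. y \<noteq> 0 \<and> dominates UNIV x y \<and> abelian_element UNIV y" using y by blast
qed

lemma normal_ideals_imp_semifinite:
  assumes *: "\<And>J :: 'a::cstar_algebra set. normal_ideal J \<Longrightarrow> J \<noteq> {0} \<Longrightarrow>
    \<exists>B \<subseteq> J. B \<noteq> {0} \<and> finite_hereditary B"
  shows "semifinite_algebra (UNIV :: 'a set)"
  unfolding semifinite_algebra_def pos_cone_UNIV
proof (intro ballI impI)
  fix x :: 'a assume "x \<in> {a. pos a}" and x0: "x \<noteq> 0"
  then have x: "pos x" by simp
  have "annihilator (two_sided_annihilator x) \<noteq> {0}"
    using pos_mem_double_annihilator[OF x] x0 by blast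
  then obtain B where B: "B \<subseteq> annihilator (two_sided_annihilator x)" "B \<noteq> {0}"
    "hereditary_subalgebra B" "finite_algebra B"
    using *[OF normal_ideal_double_annihilator] by (auto simp: finite_hereditary_def)
  obtain v where v: "corner (v * star v) \<noteq> {0}" "\<forall>b. star v * b * v \<in> B"
    "\<forall>y\<in>corner (v * star v). pos y \<longrightarrow> (\<exists>C>0. pos (C *\<^sub>R x - y))"
    using linked_corner_exists[OF x B(3,2,1)] .
  have f: "star (v * star v) = v * star v" by (simp add: star_mult star_star)
  obtain y where y: "y \<in> corner (v * star v)" "pos y" "y \<noteq> 0" "dominates UNIV x y"
    using dominated_in_corner[OF f v(1,3) x] .
  have "finite_element UNIV y"
    by (rule finite_element_if_corner_finite[OF f finite_corner_conj[OF v(2) B(4)] y(1-3)])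
  then show "\<exists>y. y \<noteq> 0 \<and> dominates UNIV x y \<and> finite_element UNIV y" using y by blast
qed

text \<open>A cycle: discreteness gives the closed-ideal condition, this restricts to normal ideals
  because annihilators are closed, and the normal-ideal condition gives discreteness.\<close>

lemma discrete_iff:
  shows "discrete_algebra (UNIV :: 'a::cstar_algebra set) \<longleftrightarrow>
      (\<forall>J :: 'a set. closed_ideal J \<and> J \<noteq> {0} \<longrightarrow> (\<exists>B \<subseteq> J. B \<noteq> {0} \<and> abelian_hereditary B))"
    and "discrete_algebra (UNIV :: 'a::cstar_algebra set) \<longleftrightarrow>
      (\<forall>J :: 'a set. normal_ideal J \<and> J \<noteq> {0} \<longrightarrow> (\<exists>B \<subseteq> J. B \<noteq> {0} \<and> abelian_hereditary B))"
  using discrete_imp_ideals[where 'a='a] normal_ideals_imp_discrete[where 'a='a]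
    normal_ideal_closed[where 'a='a] by blast+

lemma semifinite_iff:
  shows "semifinite_algebra (UNIV :: 'a::cstar_algebra set) \<longleftrightarrow>
      (\<forall>J :: 'a set. closed_ideal J \<and> J \<noteq> {0} \<longrightarrow> (\<exists>B \<subseteq> J. B \<noteq> {0} \<and> finite_hereditary B))"
    and "semifinite_algebra (UNIV :: 'a::cstar_algebra set) \<longleftrightarrow>
      (\<forall>J :: 'a set. normal_ideal J \<and> J \<noteq> {0} \<longrightarrow> (\<exists>B \<subseteq> J. B \<noteq> {0} \<and> finite_hereditary B))"
  using semifinite_imp_ideals[where 'a='a] normal_ideals_imp_semifinite[where 'a='a]
    normal_ideal_closed[where 'a='a] by blast+

theorem theorem1p2:
  shows
    "((discrete_algebra (UNIV :: 'a::cstar_algebra set) \<longleftrightarrow>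
        (\<forall>J :: 'a set. closed_ideal J \<and> J \<noteq> {0} \<longrightarrow>
           (\<exists>B \<subseteq> J. B \<noteq> {0} \<and> abelian_hereditary B))) \<and>
      (discrete_algebra (UNIV :: 'a set) \<longleftrightarrow>
        (\<forall>J :: 'a set. normal_ideal J \<and> J \<noteq> {0} \<longrightarrow>
           (\<exists>B \<subseteq> J. B \<noteq> {0} \<and> abelian_hereditary B)))) \<and>
     ((type_II_algebra (UNIV :: 'a set) \<longleftrightarrow>
        \<not> (\<exists>B :: 'a set. B \<noteq> {0} \<and> abelian_hereditary B) \<and>
        (\<forall>J :: 'a set. closed_ideal J \<and> J \<noteq> {0} \<longrightarrow>
           (\<exists>B \<subseteq> J. B \<noteq> {0} \<and> finite_hereditary B))) \<and>
      (type_II_algebra (UNIV :: 'a set) \<longleftrightarrow>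
        \<not> (\<exists>B :: 'a set. B \<noteq> {0} \<and> abelian_hereditary B) \<and>
        (\<forall>J :: 'a set. normal_ideal J \<and> J \<noteq> {0} \<longrightarrow>
           (\<exists>B \<subseteq> J. B \<noteq> {0} \<and> finite_hereditary B)))) \<and>
     (type_III_algebra (UNIV :: 'a set) \<longleftrightarrow>
        \<not> (\<exists>B :: 'a set. B \<noteq> {0} \<and> finite_hereditary B))"
  unfolding type_II_algebra_def type_III_algebra_def abelian_element_iff_hereditary
    finite_element_iff_hereditary semifinite_iff(1)[symmetric] semifinite_iff(2)[symmetric]
    discrete_iff(1)[symmetric] discrete_iff(2)[symmetric]
  by blast

end
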